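(* Let $d\ge1$ be an integer, let $M>0$, let $\tau>0$ be such that $\tau^2M^2<1$, and let $0<\lambda<\sqrt{1-\tau^2M^2}$. Let $K^{\rm Volt}:K_M\times K_M\to\mathbb{R}$, $K^{\rm Volt}({\bf z},{\bf z}')=\langle H^{\rm Volt}_\lambda({\bf z}),H^{\rm Volt}_\lambda({\bf z}')\rangle_{T_2(\mathbb{R}^d)}$, be the Volterra reservoir kernel map and let $K^{\rm Volt}(K_M)$ be the associated space of kernel sections. Then $$K^{\rm Volt}(K_M)=C^0(K_M),$$ that is, the Volterra reservoir kernel is universal.
   Context: Notation. $\mathbb{Z}_-$ denotes the negative integers including $0$; $\|\cdot\|$ and $\langle\cdot,\cdot\rangle$ are the Euclidean norm and inner product on $\mathbb{R}^d$ and those induced on tensor spaces. $K_M=\{{\bf z}\in(\mathbb{R}^d)^{\mathbb{Z}_-}\mid\|{\bf z}_t\|\le M\text{ for all }t\in\mathbb{Z}_-\}$ is endowed with the product topology (so it is compact), and $C^0(K_M)$ is the space of real-valued continuous functions on $K_M$. Tensor algebras. For a real inner product space $V$, let $T^0(V)=\mathbb{R}$, let $T^l(V)=V^{\otimes l}$ with the induced inner product determined by $\langle v_1\otimes\cdots\otimes v_l,w_1\otimes\cdots\otimes w_l\rangle=\prod_i\langle v_i,w_i\rangle$, and let $T(V)=\bigoplus_{l\ge0}T^l(V)$ with inner product $\langle\sum_l\mathbf{v}_l,\sum_l\mathbf{w}_l\rangle=\sum_l\langle\mathbf{v}_l,\mathbf{w}_l\rangle$, where $\mathbf{v}_l,\mathbf{w}_l\in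 T^l(V)$. $\overline{T(V)}$ is the Hilbert space completion. The double tensor algebra is $T_2(\mathbb{R}^d)=\overline{T(\overline{T(\mathbb{R}^d)})}$. $\tau$-tensorization. For ${\bf z}\in\mathbb{R}^d$, $\widetilde{\bf z}=1+\sum_{i=1}^\infty\tau^i\,{\bf z}^{\otimes i}$, where ${\bf z}^{\otimes i}\in T^i(\mathbb{R}^d)$; when $\tau^2\|{\bf z}\|^2<1$ this lies in $\overline{T(\mathbb{R}^d)}$. Volterra functional. For ${\bf z}\in K_M$, the recursion $\mathbf{x}_t=\lambda\,\mathbf{x}_{t-1}\otimes\widetilde{\bf z}_t+1$, $t\in\mathbb{Z}_-$, has a unique solution in $(T_2(\mathbb{R}^d))^{\mathbb{Z}_-}$. Here $1\in\mathbb{R}=T^0(\overline{T(\mathbb{R}^d)})$, $\otimes$ is the (outer) tensor product of $T_2(\mathbb{R}^d)$, and $\widetilde{\bf z}_t\in\overline{T(\mathbb{R}^d)}$ is regarded as a degree-one element of $T_2(\mathbb{R}^d)$. The Volterra functional $H^{\rm Volt}_\lambda:K_M\to T_2(\mathbb{R}^d)$ is the value of this solution at time $0$: $H^{\rm Volt}_\lambda({\bf z})=\mathbf{x}_0=1+\sum_{j=0}^\infty\lambda^{j+1}\,\widetilde{\bf z}_{-j}\otimes\widetilde{\bf z}_{-j+1}\otimes\cdots\otimes\widetilde{\bf z}_0$. Space of kernel sections. $K^{\rm Volt}(K_M)$ is the set of all functions on $K_M$ that are uniform limits of functions of the form $\sum_{i=1}^n a_iK^{\rm Volt}({\bf z}_i,\cdot)$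 with $n\in\mathbb{N}$, $a_i\in\mathbb{R}$, ${\bf z}_i\in K_M$. Universality of the kernel refers to the displayed equality. *)

theory Defs
  imports "HOL-Analysis.Analysis" "HOL-Analysis.Finite_Function_Topology"
begin

section \<open>The tensor algebra of a real inner product space\<close>

text \<open>
  \<open>'a list free\<close> is the free real vector space on the words
  \<open>[v\<^sub>1, \<dots>, v\<^sub>l]\<close>. Its quotient by the multilinearity relations is the algebraic direct
  sum of the tensor powers \<open>V\<^sup>\<otimes>\<^sup>l\<close>: the relations only involve words of equal length, and the
  class of \<open>[v\<^sub>1, \<dots>, v\<^sub>l]\<close> is \<open>v\<^sub>1 \<otimes> \<cdots> \<otimes> v\<^sub>l\<close>.
\<close>

type_synonym 'a free = "'a \<Rightarrow>\<^sub>0 real"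

definition tensor_relations :: "('a::real_vector list free) set" where
  "tensor_relations =
     {Poly_Mapping.single (xs @ (u + v) # ys) 1 - Poly_Mapping.single (xs @ u # ys) 1
        - Poly_Mapping.single (xs @ v # ys) 1 | xs u v ys. True} \<union>
     {Poly_Mapping.single (xs @ (c *\<^sub>R u) # ys) 1 - c *\<^sub>R Poly_Mapping.single (xs @ u # ys) 1
        | xs c u ys. True}"

quotient_type (overloaded) 'a tensor_algebra =
  "('a::real_vector) list free" / "\<lambda>f g. f - g \<in> span tensor_relations"
proof (rule equivpI)
  show "reflp (\<lambda>f g :: 'a list free. f - g \<in> span tensor_relations)"
    by (simp add: reflp_def span_zero)
  show "symp (\<lambda>f g :: 'a list free. f - g \<in> span tensor_relations)"
  proof (rule sympI)
    fix f g :: "'a list free" assume "f - g \<in> span tensor_relations"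
    from span_neg[OF this] show "g - f \<in> span tensor_relations" by simp
  qed
  show "transp (\<lambda>f g :: 'a list free. f - g \<in> span tensor_relations)"
  proof (rule transpI)
    fix f g h :: "'a list free"
    assume "f - g \<in> span tensor_relations" "g - h \<in> span tensor_relations"
    from span_add[OF this] show "f - h \<in> span tensor_relations" by simp
  qed
qed

instantiation tensor_algebra :: (real_vector) real_vector
begin

lift_definition zero_tensor_algebra :: "'a tensor_algebra" is 0 .

lift_definition plus_tensor_algebra :: "'a tensor_algebra \<Rightarrow> 'a tensor_algebra \<Rightarrow> 'a tensor_algebra"
  is "(+)"
  by (simp only: add_diff_add span_add)

lift_definition uminus_tensor_algebra :: "'a tensor_algebra \<Rightarrow> 'a tensor_algebra"
  is uminus
  by (simp only: minus_diff_minus span_neg)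

lift_definition minus_tensor_algebra :: "'a tensor_algebra \<Rightarrow> 'a tensor_algebra \<Rightarrow> 'a tensor_algebra"
  is "(-)"
proof -
  fix f f' g g' :: "'a list free"
  assume "f - f' \<in> span tensor_relations" "g - g' \<in> span tensor_relations"
  from span_diff[OF this] show "f - g - (f' - g') \<in> span tensor_relations"
    by (simp add: algebra_simps)
qed

lift_definition scaleR_tensor_algebra :: "real \<Rightarrow> 'a tensor_algebra \<Rightarrow> 'a tensor_algebra"
  is scaleR
  by (simp only: span_scale flip: scaleR_right_diff_distrib)

instance
proof
  fix a b c :: "'a tensor_algebra" and r s :: real
  show "a + b + c = a + (b + c)" by transfer (simp add: span_zero add.assoc)
  show "a + b = b + a" by transfer (simp add: span_zero)
  show "0 + a = a" by transfer (simp add: span_zero)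
  show "- a + a = 0" by transfer (simp add: span_zero)
  show "a - b = a + - b" by transfer (simp add: span_zero)
  show "r *\<^sub>R (a + b) = r *\<^sub>R a + r *\<^sub>R b" by transfer (simp add: span_zero scaleR_add_right)
  show "(r + s) *\<^sub>R a = r *\<^sub>R a + s *\<^sub>R a" by transfer (simp add: span_zero scaleR_add_left)
  show "r *\<^sub>R s *\<^sub>R a = (r * s) *\<^sub>R a" by transfer (simp add: span_zero)
  show "1 *\<^sub>R a = a" by transfer (simp add: span_zero)
qed

end

lift_definition tensor :: "'a::real_vector list \<Rightarrow> 'a tensor_algebra"
  is "\<lambda>xs. Poly_Mapping.single xs 1" .

lemma tensor_add: "tensor (xs @ (u + v) # ys) = tensor (xs @ u # ys) + tensor (xs @ v # ys)"
proof transfer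
  fix xs ys :: "'a list" and u v
  have "Poly_Mapping.single (xs @ (u + v) # ys) 1 - Poly_Mapping.single (xs @ u # ys) 1
      - Poly_Mapping.single (xs @ v # ys) 1 \<in> (tensor_relations :: 'a list free set)"
    unfolding tensor_relations_def by blast
  from span_base[OF this]
  show "Poly_Mapping.single (xs @ (u + v) # ys) 1 -
      (Poly_Mapping.single (xs @ u # ys) 1 + Poly_Mapping.single (xs @ v # ys) 1)
      \<in> span (tensor_relations :: 'a list free set)"
    by (simp only: diff_diff_add)
qed

lemma tensor_scaleR: "tensor (xs @ (c *\<^sub>R u) # ys) = c *\<^sub>R tensor (xs @ u # ys)"
proof transfer
  fix xs ys :: "'a list" and c u
  show "Poly_Mapping.single (xs @ (c *\<^sub>R u) # ys) 1 - c *\<^sub>R Poly_Mapping.single (xs @ u # ys) 1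
      \<in> span (tensor_relations :: 'a list free set)"
    by (rule span_base) (unfold tensor_relations_def, blast)
qed

definition free_extend :: "('a \<Rightarrow> 'b::real_vector) \<Rightarrow> ('a free) \<Rightarrow> 'b" where
  "free_extend \<phi> f = (\<Sum>x \<in> Poly_Mapping.keys f. Poly_Mapping.lookup f x *\<^sub>R \<phi> x)"

lemma lookup_scaleR': "Poly_Mapping.lookup (c *\<^sub>R f) x = c *\<^sub>R Poly_Mapping.lookup f x"
  by (simp add: scaleR_poly_mapping_def)

lemma free_extend_superset:
  assumes "finite A" "Poly_Mapping.keys f \<subseteq> A"
  shows "free_extend \<phi> f = (\<Sum>x \<in> A. Poly_Mapping.lookup f x *\<^sub>R \<phi> x)"
  unfolding free_extend_def
  by (rule sum.mono_neutral_left) (use assms in \<open>auto simp: in_keys_iff\<close>)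

lemma linear_free_extend: "linear (free_extend \<phi>)"
proof
  fix f g :: "'a free" and c :: real
  let ?A = "Poly_Mapping.keys f \<union> Poly_Mapping.keys g"
  have "Poly_Mapping.keys (f + g) \<subseteq> ?A" by (rule keys_add)
  then show "free_extend \<phi> (f + g) = free_extend \<phi> f + free_extend \<phi> g"
    by (simp add: free_extend_superset[of ?A] lookup_add scaleR_add_left sum.distrib)
  have "Poly_Mapping.keys (c *\<^sub>R f) \<subseteq> Poly_Mapping.keys f"
    by (auto simp: in_keys_iff lookup_scaleR')
  then show "free_extend \<phi> (c *\<^sub>R f) = c *\<^sub>R free_extend \<phi> f"
    by (simp add: free_extend_superset[of "Poly_Mapping.keys f"] lookup_scaleR' scaleR_sum_right)
qed

lemma free_extend_single [simp]: "free_extend \<phi> (Poly_Mapping.single x c) = c *\<^sub>R \<phi> x"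
  by (simp add: free_extend_def)

lemma free_eq_sum_single:
  "f = (\<Sum>x \<in> Poly_Mapping.keys f. Poly_Mapping.lookup f x *\<^sub>R Poly_Mapping.single x (1::real))"
proof (rule poly_mapping_eqI)
  fix k
  have "(\<Sum>x\<in>Poly_Mapping.keys f.
          Poly_Mapping.lookup f x * Poly_Mapping.lookup (Poly_Mapping.single x (1::real)) k) =
        (\<Sum>x\<in>Poly_Mapping.keys f. if x = k then Poly_Mapping.lookup f x else 0)"
    by (rule sum.cong) (auto simp: lookup_single when_def)
  then show "Poly_Mapping.lookup f k = Poly_Mapping.lookup
      (\<Sum>x \<in> Poly_Mapping.keys f. Poly_Mapping.lookup f x *\<^sub>R Poly_Mapping.single x (1::real)) k"
    by (auto simp: lookup_sum lookup_scaleR' sum.delta in_keys_iff)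
qed

lemma tensor_algebra_sum:
  fixes x :: "'a::real_vector tensor_algebra"
  obtains A c where "finite A" "x = (\<Sum>w\<in>A. c w *\<^sub>R tensor w)"
proof -
  define f where "f = rep_tensor_algebra x"
  have abs_eq: "x = abs_tensor_algebra f"
    using Quotient_abs_rep[OF Quotient_tensor_algebra, of x] by (simp add: f_def)
  define F where "F = abs_tensor_algebra \<circ> (\<lambda>f::'a list free. f)"
  have lin: "linear F"
    by standard (simp_all add: F_def plus_tensor_algebra.abs_eq scaleR_tensor_algebra.abs_eq)
  have "x = F f" by (simp add: F_def abs_eq)
  also have "\<dots> = F (\<Sum>w\<in>Poly_Mapping.keys f. Poly_Mapping.lookup f w *\<^sub>R Poly_Mapping.single w 1)"
    by (subst free_eq_sum_single[of f]) (rule refl)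
  also have "\<dots> = (\<Sum>w\<in>Poly_Mapping.keys f. Poly_Mapping.lookup f w *\<^sub>R tensor w)"
    by (simp add: linear_sum[OF lin] linear_cmul[OF lin] o_def)
       (simp add: F_def tensor.abs_eq)
  finally show ?thesis by (rule that[OF finite_keys])
qed

lemma span_range_tensor: "span (range tensor) = UNIV"
proof -
  have "x \<in> span (range tensor)" for x :: "'a tensor_algebra"
  proof -
    obtain A c where "x = (\<Sum>w\<in>A. c w *\<^sub>R tensor w)" by (rule tensor_algebra_sum)
    then show ?thesis by (auto intro!: span_sum intro: span_scale span_base)
  qed
  then show ?thesis by blast
qed

text \<open>The inner product of elementary tensors; tensors of different degree are orthogonal.\<close>

definition word_inner :: "'a::real_inner list \<Rightarrow> 'a list \<Rightarrow> real" where
  "word_inner xs ys = (if length xs = length ys then \<Prod>i<length xs. inner (xs ! i) (ys ! i) else 0)"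

lemma word_inner_simps [simp]:
  "word_inner [] [] = 1"
  "word_inner [] (y # ys) = 0"
  "word_inner (x # xs) [] = 0"
  "word_inner (x # xs) (y # ys) = inner x y * word_inner xs ys"
  by (simp_all add: word_inner_def prod.lessThan_Suc_shift del: prod.lessThan_Suc)

lemma word_inner_Nil:
  "word_inner [] ys = (if ys = [] then 1 else 0)" "word_inner xs [] = (if xs = [] then 1 else 0)"
  by (auto simp: word_inner_def)

lemma word_inner_commute: "word_inner xs ys = word_inner ys xs"
  by (auto simp: word_inner_def inner_commute)

lemma word_inner_add:
  "word_inner (xs @ (u + v) # ys) zs = word_inner (xs @ u # ys) zs + word_inner (xs @ v # ys) zs"
proof (induction xs arbitrary: zs)
  case Nil then show ?case by (cases zs) (auto simp: inner_add_left algebra_simps)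
next
  case (Cons a xs) then show ?case by (cases zs) (auto simp: algebra_simps)
qed

lemma word_inner_scaleR:
  "word_inner (xs @ (c *\<^sub>R u) # ys) zs = c * word_inner (xs @ u # ys) zs"
proof (induction xs arbitrary: zs)
  case Nil then show ?case by (cases zs) (auto simp: algebra_simps)
next
  case (Cons a xs) then show ?case by (cases zs) (auto simp: algebra_simps)
qed

lemma word_inner_snoc: "word_inner (xs @ [v]) (ys @ [w]) = word_inner xs ys * inner v w"
proof (induction xs arbitrary: ys)
  case Nil then show ?case by (cases ys) (auto simp: word_inner_Nil)
next
  case (Cons a xs)
  then show ?case by (cases ys) (auto simp: word_inner_Nil)
qed

definition free_inner :: "('a::real_inner list free) \<Rightarrow> ('a list free) \<Rightarrow> real" where
  "free_inner f g = free_extend (\<lambda>xs. free_extend (word_inner xs) g) f"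

lemma free_inner_commute: "free_inner f g = free_inner g f"
  unfolding free_inner_def free_extend_def
  by (simp add: sum_distrib_left, subst sum.swap, simp add: mult.left_commute word_inner_commute)

lemma linear_free_inner_left: "linear (\<lambda>f. free_inner f g)"
  unfolding free_inner_def by (rule linear_free_extend)

lemma linear_free_inner_right: "linear (free_inner f)"
proof -
  have "free_inner f = (\<lambda>g. free_inner g f)" by (rule ext) (rule free_inner_commute)
  then show ?thesis using linear_free_inner_left[of f] by simp
qed

lemma free_extend_relations:
  fixes \<phi> :: "'a::real_vector list \<Rightarrow> 'b::real_vector"
  assumes "r \<in> span tensor_relations"
    and "\<And>xs u v ys. \<phi> (xs @ (u + v) # ys) = \<phi> (xs @ u # ys) + \<phi> (xs @ v # ys)"
    and "\<And>xs c u ys. \<phi> (xs @ (c *\<^sub>R u) # ys) = c *\<^sub>R \<phi> (xs @ u # ys)"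
  shows "free_extend \<phi> r = 0"
proof -
  note lin = linear_free_extend[of \<phi>]
  show ?thesis
    using assms(1)
  proof (rule linear_eq_0_on_span[OF lin, rotated])
    fix f :: "'a list free" assume "f \<in> tensor_relations"
    then show "free_extend \<phi> f = 0"
      by (auto simp: tensor_relations_def linear_diff[OF lin] linear_cmul[OF lin] assms(2,3))
  qed
qed

lemma free_inner_relations:
  assumes "r \<in> span tensor_relations"
  shows "free_inner r g = 0"
proof -
  have *: "free_extend (word_inner xs) g = free_inner (Poly_Mapping.single xs 1) g" for xs
    by (simp add: free_inner_def)
  have add: "free_extend (word_inner (xs @ (u + v) # ys)) g =
      free_extend (word_inner (xs @ u # ys)) g + free_extend (word_inner (xs @ v # ys)) g"
    for xs u v ys
    by (simp add: free_extend_def word_inner_add sum.distrib algebra_simps)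
  have scale: "free_extend (word_inner (xs @ (c *\<^sub>R u) # ys)) g =
      c *\<^sub>R free_extend (word_inner (xs @ u # ys)) g" for xs c u ys
    by (simp add: free_extend_def word_inner_scaleR sum_distrib_left algebra_simps)
  show ?thesis
    unfolding free_inner_def by (rule free_extend_relations[OF assms]) (auto simp: add scale)
qed

lift_definition tensor_inner :: "'a::real_inner tensor_algebra \<Rightarrow> 'a tensor_algebra \<Rightarrow> real"
  is free_inner
proof -
  fix f f' g g' :: "'a list free"
  assume f: "f - f' \<in> span tensor_relations" and g: "g - g' \<in> span tensor_relations"
  have "free_inner f g - free_inner f' g = 0"
    using free_inner_relations[OF f] by (simp add: linear_diff[OF linear_free_inner_left])
  moreover have "free_inner f' g - free_inner f' g' = 0"
    using free_inner_relations[OF g, of f']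
    by (simp add: linear_diff[OF linear_free_inner_right] free_inner_commute[of "g - g'"])
  ultimately show "free_inner f g = free_inner f' g'" by simp
qed

lemma tensor_inner_commute: "tensor_inner x y = tensor_inner y x"
  by transfer (rule free_inner_commute)

lemma tensor_inner_add_left: "tensor_inner (x + y) z = tensor_inner x z + tensor_inner y z"
  by transfer (rule linear_add[OF linear_free_inner_left])

lemma tensor_inner_scaleR_left: "tensor_inner (r *\<^sub>R x) y = r * tensor_inner x y"
  by transfer (simp add: linear_cmul[OF linear_free_inner_left])

lemma tensor_inner_tensor: "tensor_inner (tensor xs) (tensor ys) = word_inner xs ys"
  by transfer (simp add: free_inner_def)

lemma tensor_in_span_words:
  assumes "set xs \<subseteq> span B" "ps \<in> lists B"
  shows "tensor (ps @ xs) \<in> span (tensor ` lists B)"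
  using assms
proof (induction xs arbitrary: ps)
  case Nil then show ?case by (auto intro: span_base)
next
  case (Cons a xs)
  have "a \<in> span B" using Cons.prems by simp
  then show ?case
  proof (induction rule: span_induct_alt)
    case base
    have "tensor (ps @ 0 # xs) = 0"
      using tensor_scaleR[of ps 0 0 xs] by simp
    then show ?case by (simp add: span_zero)
  next
    case (step c x y)
    have "tensor ((ps @ [x]) @ xs) \<in> span (tensor ` lists B)"
      by (rule Cons.IH) (use Cons.prems step in auto)
    then show ?case
      using step by (simp add: tensor_add tensor_scaleR span_add span_scale)
  qed
qed

lemma word_inner_orthonormal:
  assumes "\<And>u v. u \<in> B \<Longrightarrow> v \<in> B \<Longrightarrow> inner u v = (if u = v then 1 else 0)"
    and "xs \<in> lists B" "ys \<in> lists B"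
  shows "word_inner xs ys = (if xs = ys then 1 else 0)"
  using assms(2,3)
proof (induction xs arbitrary: ys)
  case Nil then show ?case by (cases ys) auto
next
  case (Cons a xs) then show ?case by (cases ys) (auto simp: assms(1))
qed

lemma tensor_inner_sum_left: "tensor_inner (sum f A) y = (\<Sum>a\<in>A. tensor_inner (f a) y)"
proof -
  have "linear (\<lambda>x. tensor_inner x y)"
    by standard (simp_all add: tensor_inner_add_left tensor_inner_scaleR_left)
  then show ?thesis by (rule linear_sum)
qed

lemma tensor_inner_sum_right: "tensor_inner y (sum f A) = (\<Sum>a\<in>A. tensor_inner y (f a))"
  using tensor_inner_sum_left[of f A y] by (simp add: tensor_inner_commute)

lemma tensor_orthonormal_expansion:
  fixes x :: "'a::real_inner tensor_algebra"
  obtains W c where "finite W" "x = (\<Sum>w\<in>W. c w *\<^sub>R tensor w)"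
    "tensor_inner x x = (\<Sum>w\<in>W. (c w)\<^sup>2)"
proof -
  obtain A a where A: "finite A" "x = (\<Sum>w\<in>A. a w *\<^sub>R tensor w)"
    by (rule tensor_algebra_sum)
  define U where "U = (\<Union>w\<in>A. set w)"
  have "finite U" using A by (simp add: U_def)
  then obtain C where C: "finite C" "span C = span U" "pairwise orthogonal C"
    using basis_orthogonal by blast
  define B where "B = (\<lambda>v. v /\<^sub>R norm v) ` (C - {0})"
  have on: "inner u v = (if u = v then 1 else 0)" if uv: "u \<in> B" "v \<in> B" for u v
  proof -
    obtain u' v' where *: "u' \<in> C" "v' \<in> C" "u' \<noteq> 0" "v' \<noteq> 0" "u = u' /\<^sub>R norm u'" "v = v' /\<^sub>R norm v'"
      using uv unfolding B_def by blast
    show ?thesis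
    proof (cases "u' = v'")
      case True
      then show ?thesis using * by (simp add: dot_square_norm power2_eq_square)
    next
      case False
      then have "inner u' v' = 0"
        using C(3) * by (auto simp: pairwise_def orthogonal_def)
      then have "inner u v = 0" using * by simp
      moreover have "u \<noteq> v"
      proof
        assume "u = v"
        then have "u = 0" using \<open>inner u v = 0\<close> by simp
        then show False using * by simp
      qed
      ultimately show ?thesis by simp
    qed
  qed
  have "C \<subseteq> span B"
  proof
    fix v assume v: "v \<in> C"
    show "v \<in> span B"
    proof (cases "v = 0")
      case True then show ?thesis by (simp add: span_zero)
    next
      case False
      then have "norm v *\<^sub>R (v /\<^sub>R norm v) \<in> span B"
        using v by (intro span_scale span_base) (auto simp: B_def)
      then show ?thesis using False by simp
    qed
  qed
  then have "span U \<subseteq> span B"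
    using C(2) span_minimal subspace_span by blast
  then have U: "U \<subseteq> span B"
    using span_superset by blast
  have "tensor w \<in> span (tensor ` lists B)" if "w \<in> A" for w
    using tensor_in_span_words[of w B "[]"] U that by (auto simp: U_def)
  then have "x \<in> span (tensor ` lists B)"
    unfolding A(2) by (intro span_sum span_scale)
  then obtain t r where t: "finite t" "t \<subseteq> tensor ` lists B" "x = (\<Sum>y\<in>t. r y *\<^sub>R y)"
    unfolding span_explicit by blast
  obtain W where W': "W \<subseteq> lists B" "inj_on tensor W" "t = tensor ` W"
    using t(2) unfolding subset_image_inj by blast
  then have "finite W" using t(1) by (simp add: finite_image_iff)
  note W = W'(1) this W'(2,3)
  define c where "c = r \<circ> tensor"
  have x: "x = (\<Sum>w\<in>W. c w *\<^sub>R tensor w)"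
    using t(3) W by (simp add: sum.reindex c_def)
  have "tensor_inner x x = (\<Sum>w\<in>W. \<Sum>w'\<in>W. c w * (c w' * word_inner w w'))"
    unfolding x
    by (simp add: tensor_inner_sum_left tensor_inner_sum_right tensor_inner_scaleR_left
        tensor_inner_commute[of "tensor _" "_ *\<^sub>R _"] tensor_inner_tensor sum_distrib_left
        word_inner_commute mult.left_commute)
  also have "\<dots> = (\<Sum>w\<in>W. \<Sum>w'\<in>W. if w = w' then (c w)\<^sup>2 else 0)"
  proof (intro sum.cong refl)
    fix w w' assume "w \<in> W" "w' \<in> W"
    then have "word_inner w w' = (if w = w' then 1 else 0)"
      using W(1) by (intro word_inner_orthonormal[of B] on) blast+
    then show "c w * (c w' * word_inner w w') = (if w = w' then (c w)\<^sup>2 else 0)"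
      by (simp add: power2_eq_square)
  qed
  also have "\<dots> = (\<Sum>w\<in>W. (c w)\<^sup>2)"
    using W(2) by simp
  finally show ?thesis using that W(2) x by blast
qed

instantiation tensor_algebra :: (real_inner) real_inner
begin

definition inner_tensor_algebra :: "'a tensor_algebra \<Rightarrow> 'a tensor_algebra \<Rightarrow> real" where
  "inner_tensor_algebra = tensor_inner"

definition norm_tensor_algebra :: "'a tensor_algebra \<Rightarrow> real" where
  "norm_tensor_algebra x = sqrt (inner x x)"

definition sgn_tensor_algebra :: "'a tensor_algebra \<Rightarrow> 'a tensor_algebra" where
  "sgn_tensor_algebra x = x /\<^sub>R norm x"

definition dist_tensor_algebra :: "'a tensor_algebra \<Rightarrow> 'a tensor_algebra \<Rightarrow> real" where
  "dist_tensor_algebra x y = norm (x - y)"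

definition uniformity_tensor_algebra :: "('a tensor_algebra \<times> 'a tensor_algebra) filter" where
  "uniformity_tensor_algebra = (INF e\<in>{0 <..}. principal {(x, y). dist x y < e})"

definition open_tensor_algebra :: "'a tensor_algebra set \<Rightarrow> bool" where
  "open_tensor_algebra U \<longleftrightarrow> (\<forall>x\<in>U. \<forall>\<^sub>F (x', y) in uniformity. x' = x \<longrightarrow> y \<in> U)"

instance
proof
  fix x y z :: "'a tensor_algebra" and r :: real
  show "inner x y = inner y x"
    unfolding inner_tensor_algebra_def by (rule tensor_inner_commute)
  show "inner (x + y) z = inner x z + inner y z"
    unfolding inner_tensor_algebra_def by (rule tensor_inner_add_left)
  show "inner (r *\<^sub>R x) y = r * inner x y"
    unfolding inner_tensor_algebra_def by (rule tensor_inner_scaleR_left)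
  obtain W c where W: "finite W" "x = (\<Sum>w\<in>W. c w *\<^sub>R tensor w)"
      "inner x x = (\<Sum>w\<in>W. (c w)\<^sup>2)"
    unfolding inner_tensor_algebra_def by (rule tensor_orthonormal_expansion)
  show "0 \<le> inner x x"
    unfolding W(3) by (simp add: sum_nonneg)
  show "inner x x = 0 \<longleftrightarrow> x = 0"
  proof
    assume "inner x x = 0"
    then have "\<forall>w\<in>W. c w = 0"
      unfolding W(3) using W(1) by (simp add: sum_nonneg_eq_0_iff)
    then show "x = 0" unfolding W(2) by simp
  next
    assume "x = 0"
    then show "inner x x = 0"
      using tensor_inner_scaleR_left[of 0 0 0] unfolding inner_tensor_algebra_def by simp
  qed
qed (simp_all add: norm_tensor_algebra_def sgn_tensor_algebra_def dist_tensor_algebra_def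
      uniformity_tensor_algebra_def open_tensor_algebra_def)

end

lemma inner_tensor:
  "inner (tensor xs) (tensor ys) =
     (if length xs = length ys then \<Prod>i<length xs. inner (xs ! i) (ys ! i) else 0)"
  by (simp add: inner_tensor_algebra_def tensor_inner_tensor word_inner_def)

text \<open>Tensor multiplication from the right by a vector, viewed in degree one.\<close>

lift_definition tensor_snoc :: "'a::real_vector tensor_algebra \<Rightarrow> 'a \<Rightarrow> 'a tensor_algebra"
  is "\<lambda>f v. free_extend (\<lambda>xs. Poly_Mapping.single (xs @ [v]) 1) f"
proof -
  fix f g :: "'a list free" and v :: 'a
  let ?L = "free_extend (\<lambda>xs. Poly_Mapping.single (xs @ [v]) (1::real))"
  note lin = linear_free_extend[of "\<lambda>xs. Poly_Mapping.single (xs @ [v]) (1::real)"]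
  have "?L r \<in> span tensor_relations" if "r \<in> span tensor_relations" for r
    using that
  proof (induction rule: span_induct_alt)
    case base then show ?case by (simp add: linear_0[OF lin] span_zero)
  next
    case (step c x y)
    have "?L x \<in> tensor_relations"
      using step(1) unfolding tensor_relations_def
      by (auto simp: linear_diff[OF lin] linear_cmul[OF lin] simp flip: append_assoc)
         (metis append_Cons append_assoc)+
    then show ?case
      using step(2) by (simp add: linear_add[OF lin] linear_cmul[OF lin] span_add span_scale span_base)
  qed
  moreover assume "f - g \<in> span tensor_relations"
  ultimately show "?L f - ?L g \<in> span tensor_relations"
    by (metis linear_diff[OF lin])
qed

lemma tensor_snoc_tensor [simp]: "tensor_snoc (tensor xs) v = tensor (xs @ [v])"
  by transfer (simp add: span_zero)

lemma linear_tensor_snoc: "linear (\<lambda>x. tensor_snoc x v)"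
proof
  show "tensor_snoc (x + y) v = tensor_snoc x v + tensor_snoc y v" for x y
    by transfer (simp add: linear_add[OF linear_free_extend] span_zero)
  show "tensor_snoc (c *\<^sub>R x) v = c *\<^sub>R tensor_snoc x v" for c x
    by transfer (simp add: linear_cmul[OF linear_free_extend] span_zero)
qed

lemma inner_tensor_snoc: "inner (tensor_snoc x v) (tensor_snoc y w) = inner x y * inner v w"
proof -
  obtain A a where A: "x = (\<Sum>u\<in>A. a u *\<^sub>R tensor u)" by (rule tensor_algebra_sum)
  obtain B b where B: "y = (\<Sum>u\<in>B. b u *\<^sub>R tensor u)" by (rule tensor_algebra_sum)
  show ?thesis
    unfolding A B
    by (simp add: linear_sum[OF linear_tensor_snoc] linear_cmul[OF linear_tensor_snoc]
        inner_sum_left inner_sum_right inner_tensor_algebra_def[symmetric]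
        tensor_inner_tensor[folded inner_tensor_algebra_def] word_inner_snoc
        sum_distrib_left sum_distrib_right mult.assoc)
qed

lemma norm_tensor_snoc: "norm (tensor_snoc x v) = norm x * norm v"
  by (simp add: norm_eq_sqrt_inner inner_tensor_snoc real_sqrt_mult)

section \<open>The Hilbert space completion\<close>

definition completion_rel :: "(nat \<Rightarrow> 'a::real_inner) \<Rightarrow> (nat \<Rightarrow> 'a) \<Rightarrow> bool" where
  "completion_rel X Y \<longleftrightarrow> Cauchy X \<and> Cauchy Y \<and> (\<lambda>n. X n - Y n) \<longlonglongrightarrow> 0"

lemma completion_rel_refl: "Cauchy X \<Longrightarrow> completion_rel X X"
  by (simp add: completion_rel_def)

quotient_type (overloaded) 'a completion = "nat \<Rightarrow> 'a::real_inner" / partial: completion_rel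
  morphisms rep_completion Completion
proof (rule part_equivpI)
  show "\<exists>X :: nat \<Rightarrow> 'a. completion_rel X X"
    by (rule exI[of _ "\<lambda>_. 0"]) (simp add: completion_rel_refl Cauchy_convergent_iff convergent_const convergent_Cauchy)
  show "symp (completion_rel :: (nat \<Rightarrow> 'a) \<Rightarrow> _)"
    using tendsto_minus by (fastforce simp: completion_rel_def symp_def)
  show "transp (completion_rel :: (nat \<Rightarrow> 'a) \<Rightarrow> _)"
    using tendsto_add by (fastforce simp: completion_rel_def transp_def)
qed

lemma Cauchy_add_real_normed:
  fixes X Y :: "nat \<Rightarrow> 'a::real_normed_vector"
  assumes "Cauchy X" "Cauchy Y"
  shows "Cauchy (\<lambda>n. X n + Y n)"
proof (rule CauchyI)
  fix e :: real assume "0 < e"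
  then have "0 < e / 2" by simp
  obtain M where M: "\<And>m n. m \<ge> M \<Longrightarrow> n \<ge> M \<Longrightarrow> norm (X m - X n) < e / 2"
    using CauchyD[OF assms(1) \<open>0 < e / 2\<close>] by blast
  obtain N where N: "\<And>m n. m \<ge> N \<Longrightarrow> n \<ge> N \<Longrightarrow> norm (Y m - Y n) < e / 2"
    using CauchyD[OF assms(2) \<open>0 < e / 2\<close>] by blast
  have "norm (X m + Y m - (X n + Y n)) < e" if "m \<ge> max M N" "n \<ge> max M N" for m n
    using M[of m n] N[of m n] that norm_triangle_ineq[of "X m - X n" "Y m - Y n"]
    by (simp add: add_diff_add)
  then show "\<exists>M. \<forall>m\<ge>M. \<forall>n\<ge>M. norm (X m + Y m - (X n + Y n)) < e" by blast
qed

lemma Cauchy_linear_bound: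
  fixes X :: "nat \<Rightarrow> 'a::real_normed_vector"
  assumes "bounded_linear f" "Cauchy X"
  shows "Cauchy (\<lambda>n. f (X n))"
  using bounded_linear.Cauchy[OF assms] .

lemma Cauchy_inner:
  fixes X Y :: "nat \<Rightarrow> 'a::real_inner"
  assumes "Cauchy X" "Cauchy Y"
  shows "Cauchy (\<lambda>n. inner (X n) (Y n))"
proof -
  obtain A where A: "A > 0" "\<And>n. norm (X n) \<le> A"
    using Cauchy_Bseq[OF assms(1)] by (auto elim: BseqE)
  obtain B where B: "B > 0" "\<And>n. norm (Y n) \<le> B"
    using Cauchy_Bseq[OF assms(2)] by (auto elim: BseqE)
  show ?thesis
  proof (rule CauchyI)
    fix e :: real assume e: "0 < e"
    define d where "d = e / (A + B)"
    have d: "0 < d" "d * (A + B) = e" using A B e by (auto simp: d_def)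
    obtain M where M: "\<And>m n. m \<ge> M \<Longrightarrow> n \<ge> M \<Longrightarrow> norm (X m - X n) < d"
      using CauchyD[OF assms(1) d(1)] by blast
    obtain N where N: "\<And>m n. m \<ge> N \<Longrightarrow> n \<ge> N \<Longrightarrow> norm (Y m - Y n) < d"
      using CauchyD[OF assms(2) d(1)] by blast
    have "norm (inner (X m) (Y m) - inner (X n) (Y n)) < e"
      if "m \<ge> max M N" "n \<ge> max M N" for m n
    proof -
      have "inner (X m) (Y m) - inner (X n) (Y n) = inner (X m) (Y m - Y n) + inner (X m - X n) (Y n)"
        by (simp add: inner_diff_left inner_diff_right)
      also have "norm \<dots> \<le> norm (X m) * norm (Y m - Y n) + norm (X m - X n) * norm (Y n)"
        by (rule order_trans[OF norm_triangle_ineq])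
           (simp add: Cauchy_Schwarz_ineq2 add_mono)
      also have "\<dots> \<le> A * norm (Y m - Y n) + norm (X m - X n) * B"
        using A B by (intro add_mono mult_mono) auto
      also have "\<dots> < A * d + d * B"
        using A B M[of m n] N[of m n] that by (intro add_strict_mono) auto
      finally show ?thesis using d(2) by (simp add: algebra_simps)
    qed
    then show "\<exists>M. \<forall>m\<ge>M. \<forall>n\<ge>M. norm (inner (X m) (Y m) - inner (X n) (Y n)) < e" by blast
  qed
qed

lemma tendsto_inner_completion_rel:
  assumes "completion_rel X X'" "completion_rel Y Y'"
  shows "(\<lambda>n. inner (X n) (Y n) - inner (X' n) (Y' n)) \<longlonglongrightarrow> 0"
proof -
  have "Bseq X" "Bseq Y'" and lim: "(\<lambda>n. X n - X' n) \<longlonglongrightarrow> 0" "(\<lambda>n. Y n - Y' n) \<longlonglongrightarrow> 0"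
    using assms by (auto simp: completion_rel_def intro: Cauchy_Bseq)
  then obtain A B where A: "\<And>n. norm (X n) \<le> A" and B: "\<And>n. norm (Y' n) \<le> B"
    by (metis BseqE)
  have "(\<lambda>n. A * norm (Y n - Y' n) + norm (X n - X' n) * B) \<longlonglongrightarrow> A * norm (0::'a) + norm (0::'a) * B"
    by (intro tendsto_intros lim)
  then have lim0: "(\<lambda>n. A * norm (Y n - Y' n) + norm (X n - X' n) * B) \<longlonglongrightarrow> 0" by simp
  show ?thesis
  proof (rule Lim_null_comparison[OF always_eventually lim0], rule allI)
    fix n
    have "inner (X n) (Y n) - inner (X' n) (Y' n) = inner (X n) (Y n - Y' n) + inner (X n - X' n) (Y' n)"
      by (simp add: inner_diff_left inner_diff_right)
    also have "norm \<dots> \<le> norm (X n) * norm (Y n - Y' n) + norm (X n - X' n) * norm (Y' n)"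
      by (rule order_trans[OF norm_triangle_ineq]) (simp add: Cauchy_Schwarz_ineq2 add_mono)
    also have "\<dots> \<le> A * norm (Y n - Y' n) + norm (X n - X' n) * B"
      using A B by (intro add_mono mult_mono) (auto intro: order_trans[OF norm_ge_zero])
    finally show "norm (inner (X n) (Y n) - inner (X' n) (Y' n)) \<le> \<dots>" .
  qed
qed

lemma completion_rel_linear:
  assumes "bounded_linear f" "completion_rel X Y"
  shows "completion_rel (\<lambda>n. f (X n)) (\<lambda>n. f (Y n))"
proof -
  have "(\<lambda>n. f (X n - Y n)) \<longlonglongrightarrow> f 0"
    using assms by (intro bounded_linear.tendsto[OF assms(1)]) (simp add: completion_rel_def)
  then show ?thesis
    using assms
    by (simp add: completion_rel_def Cauchy_linear_bound linear_diff[OF bounded_linear.linear]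
        linear_0[OF bounded_linear.linear])
qed

lemma completion_rel_add:
  assumes "completion_rel X X'" "completion_rel Y Y'"
  shows "completion_rel (\<lambda>n. X n + Y n) (\<lambda>n. X' n + Y' n)"
  using assms tendsto_add[of "\<lambda>n. X n - X' n" 0 sequentially "\<lambda>n. Y n - Y' n" 0]
  by (simp add: completion_rel_def Cauchy_add_real_normed add_diff_add)

lemma completion_rel_uminus:
  "completion_rel X Y \<Longrightarrow> completion_rel (\<lambda>n. - X n) (\<lambda>n. - Y n)"
  by (rule completion_rel_linear[OF bounded_linear_minus[OF bounded_linear_ident]])

instantiation completion :: (real_inner) real_vector
begin

lift_definition zero_completion :: "'a completion" is "\<lambda>_. 0"
  by (rule completion_rel_refl) (simp add: convergent_Cauchy convergent_const)

lift_definition plus_completion :: "'a completion \<Rightarrow> 'a completion \<Rightarrow> 'a completion"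
  is "\<lambda>X Y n. X n + Y n"
  by (rule completion_rel_add)

lift_definition uminus_completion :: "'a completion \<Rightarrow> 'a completion" is "\<lambda>X n. - X n"
  by (rule completion_rel_uminus)

lift_definition minus_completion :: "'a completion \<Rightarrow> 'a completion \<Rightarrow> 'a completion"
  is "\<lambda>X Y n. X n - Y n"
  by (simp only: diff_conv_add_uminus completion_rel_add completion_rel_uminus)

lift_definition scaleR_completion :: "real \<Rightarrow> 'a completion \<Rightarrow> 'a completion"
  is "\<lambda>r X n. r *\<^sub>R X n"
  by (rule completion_rel_linear[OF bounded_linear_scaleR_right])

instance
proof
  fix a b c :: "'a completion" and r s :: real
  show "a + b + c = a + (b + c)"
    by transfer (auto simp: completion_rel_def add.assoc intro: Cauchy_add_real_normed)
  show "a + b = b + a"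
    by transfer (auto simp: completion_rel_def add.commute intro: Cauchy_add_real_normed)
  show "0 + a = a" by transfer (auto simp: completion_rel_def)
  show "- a + a = 0"
    by transfer (auto simp: completion_rel_def convergent_Cauchy convergent_const)
  show "a - b = a + - b"
    by transfer (simp only: diff_conv_add_uminus completion_rel_add completion_rel_uminus)
  show "r *\<^sub>R (a + b) = r *\<^sub>R a + r *\<^sub>R b"
    by transfer (simp add: scaleR_add_right completion_rel_add
        completion_rel_linear[OF bounded_linear_scaleR_right])
  show "(r + s) *\<^sub>R a = r *\<^sub>R a + s *\<^sub>R a"
    by transfer (simp add: scaleR_add_left completion_rel_add
        completion_rel_linear[OF bounded_linear_scaleR_right])
  show "r *\<^sub>R s *\<^sub>R a = (r * s) *\<^sub>R a"
    by transfer (simp add: completion_rel_linear[OF bounded_linear_scaleR_right])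
  show "1 *\<^sub>R a = a" by transfer simp
qed

end

lift_definition completion_inner :: "'a::real_inner completion \<Rightarrow> 'a completion \<Rightarrow> real"
  is "\<lambda>X Y. lim (\<lambda>n. inner (X n) (Y n))"
proof -
  fix X X' Y Y' :: "nat \<Rightarrow> 'a"
  assume rel: "completion_rel X X'" "completion_rel Y Y'"
  then have "Cauchy (\<lambda>n. inner (X n) (Y n))"
    by (intro Cauchy_inner) (auto simp: completion_rel_def)
  then obtain l where l: "(\<lambda>n. inner (X n) (Y n)) \<longlonglongrightarrow> l"
    by (auto simp: Cauchy_convergent_iff convergent_def)
  have "(\<lambda>n. inner (X' n) (Y' n)) \<longlonglongrightarrow> l"
    using tendsto_diff[OF l tendsto_inner_completion_rel[OF rel]] by simp
  then show "lim (\<lambda>n. inner (X n) (Y n)) = lim (\<lambda>n. inner (X' n) (Y' n))"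
    using l by (simp add: limI)
qed

lemma Completion_cases:
  obtains X where "x = Completion X" "Cauchy X"
proof -
  have "completion_rel (rep_completion x) (rep_completion x)"
    by (rule Quotient_rep_reflp[OF Quotient_completion])
  moreover have "x = Completion (rep_completion x)"
    using Quotient_abs_rep[OF Quotient_completion, of x] by simp
  ultimately show ?thesis using that by (auto simp: completion_rel_def)
qed

lemma Completion_eq_iff:
  "Cauchy X \<Longrightarrow> Cauchy Y \<Longrightarrow> Completion X = Completion Y \<longleftrightarrow> (\<lambda>n. X n - Y n) \<longlonglongrightarrow> 0"
  using Quotient_rel[OF Quotient_completion, of X Y] by (auto simp: completion_rel_def)

lemma completion_inner_tendsto:
  assumes "Cauchy X" "Cauchy Y"
  shows "(\<lambda>n. inner (X n) (Y n)) \<longlonglongrightarrow> completion_inner (Completion X) (Completion Y)"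
proof -
  have "convergent (\<lambda>n. inner (X n) (Y n))"
    using Cauchy_inner[OF assms] by (simp add: Cauchy_convergent_iff)
  then show ?thesis
    using assms
    by (simp add: completion_inner.abs_eq completion_rel_refl convergent_LIMSEQ_iff)
qed

instantiation completion :: (real_inner) real_inner
begin

definition inner_completion :: "'a completion \<Rightarrow> 'a completion \<Rightarrow> real" where
  "inner_completion = completion_inner"

definition norm_completion :: "'a completion \<Rightarrow> real" where
  "norm_completion x = sqrt (inner x x)"

definition sgn_completion :: "'a completion \<Rightarrow> 'a completion" where
  "sgn_completion x = x /\<^sub>R norm x"

definition dist_completion :: "'a completion \<Rightarrow> 'a completion \<Rightarrow> real" where
  "dist_completion x y = norm (x - y)"

definition uniformity_completion :: "('a completion \<times> 'a completion) filter" where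
  "uniformity_completion = (INF e\<in>{0 <..}. principal {(x, y). dist x y < e})"

definition open_completion :: "'a completion set \<Rightarrow> bool" where
  "open_completion U \<longleftrightarrow> (\<forall>x\<in>U. \<forall>\<^sub>F (x', y) in uniformity. x' = x \<longrightarrow> y \<in> U)"

instance
proof
  fix x y z :: "'a completion" and r :: real
  obtain X where x: "x = Completion X" and X: "Cauchy X" by (rule Completion_cases)
  obtain Y where y: "y = Completion Y" and Y: "Cauchy Y" by (rule Completion_cases)
  obtain Z where z: "z = Completion Z" and Z: "Cauchy Z" by (rule Completion_cases)
  note lims = completion_inner_tendsto
  show "inner x y = inner y x"
    unfolding inner_completion_def x y
    using lims[OF X Y] lims[OF Y X] by (simp add: inner_commute LIMSEQ_unique)
  have xy: "x + y = Completion (\<lambda>n. X n + Y n)"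
    by (simp add: x y plus_completion.abs_eq completion_rel_refl X Y)
  show "inner (x + y) z = inner x z + inner y z"
    unfolding inner_completion_def xy unfolding x y z
    using lims[OF Cauchy_add_real_normed[OF X Y] Z] tendsto_add[OF lims[OF X Z] lims[OF Y Z]]
    by (simp add: inner_add_left LIMSEQ_unique)
  have rx: "r *\<^sub>R x = Completion (\<lambda>n. r *\<^sub>R X n)"
    by (simp add: x scaleR_completion.abs_eq completion_rel_refl X)
  show "inner (r *\<^sub>R x) y = r * inner x y"
    unfolding inner_completion_def rx unfolding x y
    using lims[OF Cauchy_linear_bound[OF bounded_linear_scaleR_right[of r] X] Y]
      tendsto_mult_left[OF lims[OF X Y], of r]
    by (simp add: LIMSEQ_unique)
  note xx = lims[OF X X, folded inner_completion_def x]
  show "0 \<le> inner x x"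
    by (rule LIMSEQ_le_const[OF xx]) auto
  show "inner x x = 0 \<longleftrightarrow> x = 0"
  proof -
    have "inner x x = 0 \<longleftrightarrow> (\<lambda>n. (norm (X n))\<^sup>2) \<longlonglongrightarrow> 0"
      using xx LIMSEQ_unique by (auto simp: power2_norm_eq_inner)
    also have "\<dots> \<longleftrightarrow> X \<longlonglongrightarrow> 0"
      by (simp add: tendsto_norm_zero_iff)
    also have "\<dots> \<longleftrightarrow> x = 0"
      unfolding x zero_completion_def
      using X by (simp add: Completion_eq_iff convergent_Cauchy convergent_const)
    finally show ?thesis .
  qed
qed (simp_all add: norm_completion_def sgn_completion_def dist_completion_def
      uniformity_completion_def open_completion_def)

end

lemma inner_Completion:
  assumes "Cauchy X" "Cauchy Y"
  shows "(\<lambda>n. inner (X n) (Y n)) \<longlonglongrightarrow> inner (Completion X) (Completion Y)"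
  unfolding inner_completion_def by (rule completion_inner_tendsto[OF assms])

lemma norm_Completion:
  assumes "Cauchy X"
  shows "(\<lambda>n. norm (X n)) \<longlonglongrightarrow> norm (Completion X)"
  unfolding norm_eq_sqrt_inner by (intro tendsto_real_sqrt inner_Completion assms)

lift_definition to_completion :: "'a::real_inner \<Rightarrow> 'a completion" is "\<lambda>x _. x"
  by (rule completion_rel_refl) (simp add: convergent_Cauchy convergent_const)

lemma Cauchy_const: "Cauchy (\<lambda>_. x :: 'a::real_normed_vector)"
  by (simp add: convergent_Cauchy convergent_const)

lemma linear_to_completion: "linear to_completion"
proof
  show "to_completion (x + y) = to_completion x + to_completion y" for x y :: 'a
    by transfer (simp add: completion_rel_refl Cauchy_const)
  show "to_completion (r *\<^sub>R x) = r *\<^sub>R to_completion x" for r and x :: 'a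
    by transfer (simp add: completion_rel_refl Cauchy_const)
qed

lemma inner_to_completion [simp]: "inner (to_completion x) (to_completion y) = inner x y"
  unfolding inner_completion_def by transfer (simp add: limI)

lemma norm_to_completion [simp]: "norm (to_completion x) = norm x"
  by (simp add: norm_eq_sqrt_inner)

lemma to_completion_tendsto:
  assumes "Cauchy X"
  shows "(\<lambda>n. to_completion (X n)) \<longlonglongrightarrow> Completion X"
proof (rule LIMSEQ_I)
  fix e :: real assume "0 < e"
  then obtain N where N: "\<And>m n. m \<ge> N \<Longrightarrow> n \<ge> N \<Longrightarrow> norm (X m - X n) < e / 2"
    using CauchyD[OF assms, of "e / 2"] by auto
  have "norm (to_completion (X n) - Completion X) < e" if "n \<ge> N" for n
  proof -
    have c: "Cauchy (\<lambda>m. X n - X m)"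
      using Cauchy_add_real_normed[OF Cauchy_const[of "X n"]
          Cauchy_linear_bound[OF bounded_linear_minus[OF bounded_linear_ident] assms]] by simp
    have "to_completion (X n) - Completion X = Completion (\<lambda>m. X n - X m)"
      by (simp add: to_completion.abs_eq minus_completion.abs_eq completion_rel_refl assms Cauchy_const)
    moreover have "norm (Completion (\<lambda>m. X n - X m)) \<le> e / 2"
      using N[of n] that by (intro LIMSEQ_le_const2[OF norm_Completion[OF c]]) (auto intro!: exI[of _ N] less_imp_le)
    ultimately show ?thesis using \<open>0 < e\<close> by simp
  qed
  then show "\<exists>N. \<forall>n\<ge>N. norm (to_completion (X n) - Completion X) < e" by blast
qed

lemma closure_range_to_completion: "closure (range to_completion) = UNIV"
proof -
  have "x \<in> closure (range to_completion)" for x :: "'a completion"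
  proof (rule Completion_cases[of x])
    fix X assume "x = Completion X" "Cauchy X"
    then show ?thesis
      unfolding closure_sequential
      by (intro exI[of _ "\<lambda>n. to_completion (X n)"]) (simp add: to_completion_tendsto)
  qed
  then show ?thesis by blast
qed

instance completion :: (real_inner) complete_space
proof
  fix X :: "nat \<Rightarrow> 'a completion"
  assume X: "Cauchy X"
  have "\<exists>a. dist (to_completion a) (X n) < inverse (real (Suc n))" for n
  proof -
    have "X n \<in> closure (range to_completion)" by (simp add: closure_range_to_completion)
    then obtain y where "y \<in> range to_completion" "dist y (X n) < inverse (real (Suc n))"
      unfolding closure_approachable by (meson inverse_positive_iff_positive of_nat_0_less_iff zero_less_Suc)
    then show ?thesis by blast
  qed
  then obtain a where a: "\<And>n. dist (to_completion (a n)) (X n) < inverse (real (Suc n))" by metis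
  have "(\<lambda>n. to_completion (a n) - X n) \<longlonglongrightarrow> 0"
    by (rule Lim_null_comparison[OF _ LIMSEQ_inverse_real_of_nat])
       (use a in \<open>auto simp: dist_norm intro!: always_eventually less_imp_le\<close>)
  note lim = this
  then have "Cauchy (\<lambda>n. to_completion (a n) - X n)"
    by (simp add: LIMSEQ_imp_Cauchy)
  then have "Cauchy (\<lambda>n. to_completion (a n))"
    using Cauchy_add_real_normed[OF X, of "\<lambda>n. to_completion (a n) - X n"] by simp
  then have "Cauchy a"
    by (simp add: Cauchy_iff linear_diff[OF linear_to_completion, symmetric])
  then have "(\<lambda>n. to_completion (a n)) \<longlonglongrightarrow> Completion a"
    by (rule to_completion_tendsto)
  then have "X \<longlonglongrightarrow> Completion a"
    using tendsto_diff[OF _ lim, of "\<lambda>n. to_completion (a n)"] by simp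
  then show "convergent X" by (auto simp: convergent_def)
qed

instance completion :: (real_inner) banach ..

lemma Cauchy_to_completion_iff: "Cauchy (\<lambda>n. to_completion (X n)) \<longleftrightarrow> Cauchy X"
  by (simp add: Cauchy_iff linear_diff[OF linear_to_completion, symmetric])

lemma completion_eq_zeroI:
  assumes "\<And>y. inner x (to_completion y) = 0"
  shows "x = 0"
proof -
  obtain X where X: "x = Completion X" "Cauchy X" by (rule Completion_cases)
  have "(\<lambda>n. inner x (to_completion (X n))) \<longlonglongrightarrow> inner x x"
    using X by (auto intro!: tendsto_intros to_completion_tendsto)
  then have "inner x x = 0" using assms by (simp add: LIMSEQ_const_iff)
  then show ?thesis by simp
qed

section \<open>The double tensor algebra and the Volterra functional\<close>

lemma bounded_linear_tensor_snoc: "bounded_linear (\<lambda>x. tensor_snoc x v)"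
  using linear_tensor_snoc[of v] norm_tensor_snoc[of _ v]
  by (auto simp: bounded_linear_def bounded_linear_axioms_def)

text \<open>
  The right factor is understood to be in degree one. For such right factors the product of
  the algebraic tensor algebra is continuous in the left factor, hence it extends to the completion.
\<close>

lift_definition tensor_right ::
    "'a::real_inner tensor_algebra completion \<Rightarrow> 'a \<Rightarrow> 'a tensor_algebra completion"
    (infixl "\<otimes>\<^sub>1" 70)
  is "\<lambda>X v n. tensor_snoc (X n) v"
  by (rule completion_rel_linear[OF bounded_linear_tensor_snoc])

lemma tensor_right_to_completion [simp]: "to_completion x \<otimes>\<^sub>1 v = to_completion (tensor_snoc x v)"
  by transfer (simp add: completion_rel_refl Cauchy_const)

lemma linear_tensor_right: "linear (\<lambda>x. x \<otimes>\<^sub>1 v)"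
proof
  show "(x + y) \<otimes>\<^sub>1 v = x \<otimes>\<^sub>1 v + y \<otimes>\<^sub>1 v" for x y
    by transfer (simp add: linear_add[OF linear_tensor_snoc] completion_rel_add
        completion_rel_linear[OF bounded_linear_tensor_snoc])
  show "(c *\<^sub>R x) \<otimes>\<^sub>1 v = c *\<^sub>R (x \<otimes>\<^sub>1 v)" for c x
    by transfer (simp add: linear_cmul[OF linear_tensor_snoc]
        completion_rel_linear[OF bounded_linear_scaleR_right]
        completion_rel_linear[OF bounded_linear_tensor_snoc])
qed

lemma inner_tensor_right: "inner (x \<otimes>\<^sub>1 v) (y \<otimes>\<^sub>1 w) = inner x y * inner v w"
proof -
  obtain X where X: "x = Completion X" "Cauchy X" by (rule Completion_cases)
  obtain Y where Y: "y = Completion Y" "Cauchy Y" by (rule Completion_cases)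
  have cX: "Cauchy (\<lambda>n. tensor_snoc (X n) v)"
    by (rule Cauchy_linear_bound[OF bounded_linear_tensor_snoc X(2)])
  have cY: "Cauchy (\<lambda>n. tensor_snoc (Y n) w)"
    by (rule Cauchy_linear_bound[OF bounded_linear_tensor_snoc Y(2)])
  have "x \<otimes>\<^sub>1 v = Completion (\<lambda>n. tensor_snoc (X n) v)" "y \<otimes>\<^sub>1 w = Completion (\<lambda>n. tensor_snoc (Y n) w)"
    using X Y by (simp_all add: tensor_right.abs_eq completion_rel_refl)
  then have "(\<lambda>n. inner (tensor_snoc (X n) v) (tensor_snoc (Y n) w)) \<longlonglongrightarrow> inner (x \<otimes>\<^sub>1 v) (y \<otimes>\<^sub>1 w)"
    using inner_Completion[OF cX cY] by simp
  moreover have "(\<lambda>n. inner (X n) (Y n) * inner v w) \<longlonglongrightarrow> inner x y * inner v w"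
    using inner_Completion[OF X(2) Y(2)] X Y by (auto intro!: tendsto_intros)
  ultimately show ?thesis
    by (simp add: inner_tensor_snoc LIMSEQ_unique)
qed

lemma norm_tensor_right: "norm (x \<otimes>\<^sub>1 v) = norm x * norm v"
  by (simp add: norm_eq_sqrt_inner inner_tensor_right real_sqrt_mult)

lemma bounded_linear_tensor_right: "bounded_linear (\<lambda>x. x \<otimes>\<^sub>1 v)"
  using linear_tensor_right[of v] norm_tensor_right[of _ v]
  by (auto simp: bounded_linear_def bounded_linear_axioms_def)

lemma inner_tensor_right_unit: "inner (x \<otimes>\<^sub>1 v) (to_completion (tensor [])) = 0"
proof -
  have unit: "inner (tensor_snoc y v) (tensor []) = 0" for y
  proof -
    obtain A a where A: "y = (\<Sum>u\<in>A. a u *\<^sub>R tensor u)" by (rule tensor_algebra_sum)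
    show ?thesis
      unfolding A
      by (simp add: linear_sum[OF linear_tensor_snoc] linear_cmul[OF linear_tensor_snoc]
          inner_sum_left inner_tensor)
  qed
  obtain X where X: "x = Completion X" "Cauchy X" by (rule Completion_cases)
  have "(\<lambda>n. to_completion (X n) \<otimes>\<^sub>1 v) \<longlonglongrightarrow> x \<otimes>\<^sub>1 v"
    unfolding X(1)
    by (intro bounded_linear.tendsto[OF bounded_linear_tensor_right] to_completion_tendsto X)
  then have "(\<lambda>n. inner (to_completion (X n) \<otimes>\<^sub>1 v) (to_completion (tensor [])))
      \<longlonglongrightarrow> inner (x \<otimes>\<^sub>1 v) (to_completion (tensor []))"
    by (intro tendsto_intros)
  then show ?thesis by (simp add: unit LIMSEQ_const_iff)
qed

definition tensorization :: "real \<Rightarrow> 'a::real_inner \<Rightarrow> 'a tensor_algebra completion" where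
  "tensorization \<tau> z = to_completion (tensor []) +
     suminf (\<lambda>i. \<tau> ^ Suc i *\<^sub>R to_completion (tensor (replicate (Suc i) z)))"

text \<open>
  A sequence over the nonpositive integers is encoded as a function \<open>z\<close> on \<open>nat\<close>, where
  \<open>z j\<close> is the entry at time \<open>-j\<close>; thus \<open>Suc j\<close> is one time step before \<open>j\<close>. The topology
  on \<open>nat \<Rightarrow> real ^ 'n\<close> is the product topology.
\<close>

definition K_ball :: "real \<Rightarrow> (nat \<Rightarrow> real ^ 'n) set" where
  "K_ball M = {z. \<forall>j. norm (z j) \<le> M}"

type_synonym 'n double_tensor_algebra =
  "(real ^ 'n) tensor_algebra completion tensor_algebra completion"

definition volterra_solution ::
    "real \<Rightarrow> real \<Rightarrow> (nat \<Rightarrow> real ^ 'n) \<Rightarrow> (nat \<Rightarrow> 'n double_tensor_algebra) \<Rightarrow> bool" where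
  "volterra_solution \<tau> l z x \<longleftrightarrow>
     (\<forall>j. x j = l *\<^sub>R (x (Suc j) \<otimes>\<^sub>1 tensorization \<tau> (z j)) + to_completion (tensor []))"

text \<open>
  The \<open>THE\<close> below is justified by \<open>volterra_solution_ex1\<close>; the explicit series is
  \<open>volterra_series\<close>.
\<close>

definition volterra :: "real \<Rightarrow> real \<Rightarrow> (nat \<Rightarrow> real ^ 'n) \<Rightarrow> 'n double_tensor_algebra" where
  "volterra \<tau> l z = (THE x. volterra_solution \<tau> l z x) 0"

definition volterra_kernel :: "real \<Rightarrow> real \<Rightarrow> (nat \<Rightarrow> real ^ 'n) \<Rightarrow> (nat \<Rightarrow> real ^ 'n) \<Rightarrow> real" where
  "volterra_kernel \<tau> l z z' = inner (volterra \<tau> l z) (volterra \<tau> l z')"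

lemma tensorization_summable:
  fixes z :: "'a::real_inner"
  assumes "\<tau>\<^sup>2 * (norm z)\<^sup>2 < 1"
  shows "summable (\<lambda>i. norm (\<tau> ^ i *\<^sub>R to_completion (tensor (replicate i z))))"
proof -
  have "norm (tensor (replicate i z)) = norm z ^ i" for i
    by (simp add: norm_eq_sqrt_inner inner_tensor real_sqrt_power)
  then have "norm (\<tau> ^ i *\<^sub>R to_completion (tensor (replicate i z))) = (\<bar>\<tau>\<bar> * norm z) ^ i" for i
    by (simp add: power_abs power_mult_distrib)
  moreover have "\<bar>\<tau>\<bar> * norm z < 1"
    using assms by (intro power2_less_imp_less[of _ 1]) (auto simp: power_mult_distrib)
  ultimately show ?thesis
    by (simp add: summable_geometric)
qed

lemma tensorization_sums:
  fixes z :: "'a::real_inner"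
  assumes "\<tau>\<^sup>2 * (norm z)\<^sup>2 < 1"
  shows "(\<lambda>i. \<tau> ^ i *\<^sub>R to_completion (tensor (replicate i z))) sums tensorization \<tau> z"
proof -
  let ?f = "\<lambda>i. \<tau> ^ i *\<^sub>R to_completion (tensor (replicate i z))"
  have s: "summable ?f" by (rule summable_norm_cancel[OF tensorization_summable[OF assms]])
  then have "?f sums (suminf ?f)" by (rule summable_sums)
  also have "suminf ?f = tensorization \<tau> z"
    using suminf_split_head[OF s] by (simp add: tensorization_def)
  finally show ?thesis .
qed

lemma inner_tensorization:
  fixes z w :: "'a::real_inner"
  assumes z: "\<tau>\<^sup>2 * (norm z)\<^sup>2 < 1" and w: "\<tau>\<^sup>2 * (norm w)\<^sup>2 < 1"
  shows "inner (tensorization \<tau> z) (tensorization \<tau> w) = 1 / (1 - \<tau>\<^sup>2 * inner z w)"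
proof -
  let ?e = "\<lambda>z i. to_completion (tensor (replicate i z)) :: 'a tensor_algebra completion"
  have ee: "inner (?e z i) (?e w j) = (if j = i then inner z w ^ i else 0)" for i j
    by (simp add: inner_tensor)
  have ew: "inner (?e z i) (tensorization \<tau> w) = \<tau> ^ i * inner z w ^ i" for i
  proof -
    have "(\<lambda>j. inner (?e z i) (\<tau> ^ j *\<^sub>R ?e w j)) sums inner (?e z i) (tensorization \<tau> w)"
      by (rule bounded_linear.sums[OF bounded_linear_inner_right tensorization_sums[OF w]])
    moreover have "(\<lambda>j. inner (?e z i) (\<tau> ^ j *\<^sub>R ?e w j)) =
        (\<lambda>j. if j = i then \<tau> ^ i * inner z w ^ i else 0)"
      by (rule ext) (simp only: inner_scaleR_right ee, auto)
    ultimately show ?thesis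
      using sums_single[of i "\<lambda>_. \<tau> ^ i * inner z w ^ i"] by (simp add: sums_unique2)
  qed
  have "(\<lambda>i. inner (\<tau> ^ i *\<^sub>R ?e z i) (tensorization \<tau> w)) sums inner (tensorization \<tau> z) (tensorization \<tau> w)"
    by (rule bounded_linear.sums[OF bounded_linear_inner_left tensorization_sums[OF z]])
  moreover have "inner (\<tau> ^ i *\<^sub>R ?e z i) (tensorization \<tau> w) = (\<tau>\<^sup>2 * inner z w) ^ i" for i
    by (simp only: inner_scaleR_left ew) (simp add: power2_eq_square power_mult_distrib)
  ultimately have s: "(\<lambda>i. (\<tau>\<^sup>2 * inner z w) ^ i) sums inner (tensorization \<tau> z) (tensorization \<tau> w)"
    by simp
  have "\<bar>\<tau>\<^sup>2 * inner z w\<bar> \<le> (\<bar>\<tau>\<bar> * norm z) * (\<bar>\<tau>\<bar> * norm w)"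
    using mult_left_mono[OF Cauchy_Schwarz_ineq2[of z w], of "\<tau>\<^sup>2"]
    by (simp add: abs_mult power2_eq_square mult_ac)
  also have "\<dots> < 1"
  proof -
    have "\<bar>\<tau>\<bar> * norm z < 1" "\<bar>\<tau>\<bar> * norm w < 1"
      using z w by (auto intro!: power2_less_imp_less[of _ 1] simp: power_mult_distrib)
    then show ?thesis
      by (metis abs_ge_zero mult_less_cancel_right2 mult_nonneg_nonneg norm_ge_zero
          mult_strict_mono' mult.right_neutral zero_less_one)
  qed
  finally have "(\<lambda>i. (\<tau>\<^sup>2 * inner z w) ^ i) sums (1 / (1 - \<tau>\<^sup>2 * inner z w))"
    by (intro geometric_sums) simp
  then show ?thesis using s by (rule sums_unique2[symmetric])
qed

lemma volterra_solution_unique: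
  assumes x: "volterra_solution \<tau> l z x" and y: "volterra_solution \<tau> l z y"
  shows "x = y"
proof
  fix j
  have rec: "x j - y j = l *\<^sub>R ((x (Suc j) - y (Suc j)) \<otimes>\<^sub>1 tensorization \<tau> (z j))" for j
  proof -
    have "x j = l *\<^sub>R (x (Suc j) \<otimes>\<^sub>1 tensorization \<tau> (z j)) + to_completion (tensor [])"
      using x unfolding volterra_solution_def by blast
    moreover have "y j = l *\<^sub>R (y (Suc j) \<otimes>\<^sub>1 tensorization \<tau> (z j)) + to_completion (tensor [])"
      using y unfolding volterra_solution_def by blast
    ultimately show ?thesis
      by (simp add: linear_diff[OF linear_tensor_right] scaleR_diff_right)
  qed
  have word: "inner (x j - y j) (to_completion (tensor w)) = 0" for w
  proof (induction w arbitrary: j rule: rev_induct)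
    case Nil
    show ?case by (subst rec) (simp add: inner_tensor_right_unit)
  next
    case (snoc v w)
    have "inner (x j - y j) (to_completion (tensor (w @ [v]))) =
        l * inner ((x (Suc j) - y (Suc j)) \<otimes>\<^sub>1 tensorization \<tau> (z j)) (to_completion (tensor w) \<otimes>\<^sub>1 v)"
      by (subst rec) simp
    also have "\<dots> = 0" by (simp only: inner_tensor_right snoc.IH mult_zero_left mult_zero_right)
    finally show ?case .
  qed
  have "x j - y j = 0"
  proof (rule completion_eq_zeroI)
    fix u :: "(real ^ 'a) tensor_algebra completion tensor_algebra"
    obtain A a where "u = (\<Sum>w\<in>A. a w *\<^sub>R tensor w)" by (rule tensor_algebra_sum)
    then show "inner (x j - y j) (to_completion u) = 0"
      by (simp only: linear_sum[OF linear_to_completion] linear_cmul[OF linear_to_completion]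
          inner_sum_right inner_scaleR_right word) simp
  qed
  then show "x j = y j" by simp
qed

definition volterra_term :: "real \<Rightarrow> (nat \<Rightarrow> real ^ 'n) \<Rightarrow> nat \<Rightarrow> nat \<Rightarrow> 'n double_tensor_algebra" where
  "volterra_term \<tau> z j m = to_completion (tensor (map (\<lambda>i. tensorization \<tau> (z i)) (rev [j..<j + m])))"

lemma volterra_term_0: "volterra_term \<tau> z j 0 = to_completion (tensor [])"
  by (simp add: volterra_term_def)

lemma volterra_term_Suc:
  "volterra_term \<tau> z j (Suc m) = volterra_term \<tau> z (Suc j) m \<otimes>\<^sub>1 tensorization \<tau> (z j)"
proof -
  have "[j..<j + Suc m] = j # [Suc j..<Suc j + m]" by (simp add: upt_conv_Cons)
  then show ?thesis by (simp add: volterra_term_def)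
qed

lemma volterra_term_summable:
  fixes z :: "nat \<Rightarrow> real ^ 'n"
  assumes z: "z \<in> K_ball M" and M: "\<tau>\<^sup>2 * M\<^sup>2 < 1"
    and l: "0 < l" "l < sqrt (1 - \<tau>\<^sup>2 * M\<^sup>2)"
  shows "summable (\<lambda>m. norm (l ^ m *\<^sub>R volterra_term \<tau> z j m))"
proof -
  define q where "q = sqrt (1 - \<tau>\<^sup>2 * M\<^sup>2)"
  have q: "0 < q" "l < q" using M l by (auto simp: q_def)
  have nz: "(norm (z i))\<^sup>2 \<le> M\<^sup>2" for i
    using z by (auto simp: K_ball_def intro: power_mono)
  have bound: "norm (tensorization \<tau> (z i)) \<le> 1 / q" for i
  proof -
    have le: "\<tau>\<^sup>2 * (norm (z i))\<^sup>2 \<le> \<tau>\<^sup>2 * M\<^sup>2" using nz by (intro mult_left_mono) auto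
    then have lt: "\<tau>\<^sup>2 * (norm (z i))\<^sup>2 < 1" using M by simp
    have "norm (tensorization \<tau> (z i)) = sqrt (1 / (1 - \<tau>\<^sup>2 * (norm (z i))\<^sup>2))"
      by (simp add: norm_eq_sqrt_inner inner_tensorization[OF lt lt] power2_norm_eq_inner)
    also have "\<dots> \<le> sqrt (1 / (1 - \<tau>\<^sup>2 * M\<^sup>2))"
      using le lt M by (intro real_sqrt_le_mono divide_left_mono) auto
    finally show ?thesis by (simp add: q_def real_sqrt_divide)
  qed
  have "norm (volterra_term \<tau> z j m) \<le> (1 / q) ^ m" for m
  proof (induction m arbitrary: j)
    case 0 show ?case by (simp add: volterra_term_0 norm_eq_sqrt_inner inner_tensor)
  next
    case (Suc m)
    have "norm (volterra_term \<tau> z j (Suc m)) \<le> (1 / q) ^ m * (1 / q)"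
      unfolding volterra_term_Suc norm_tensor_right
      using Suc.IH bound q by (intro mult_mono) auto
    then show ?case by (simp add: mult.commute)
  qed
  then have le: "norm (l ^ m *\<^sub>R volterra_term \<tau> z j m) \<le> (l / q) ^ m" for m
    using l mult_left_mono[of "norm (volterra_term \<tau> z j m)" "(1 / q) ^ m" "l ^ m"]
    by (simp add: power_divide)
  have s: "summable (\<lambda>m. (l / q) ^ m)"
    using q l by (intro summable_geometric) simp
  show ?thesis
    by (rule summable_comparison_test'[OF s, of 0]) (simp only: real_norm_def abs_norm_cancel le)
qed

lemma volterra_solution_series:
  fixes z :: "nat \<Rightarrow> real ^ 'n"
  assumes "z \<in> K_ball M" "\<tau>\<^sup>2 * M\<^sup>2 < 1" "0 < l" "l < sqrt (1 - \<tau>\<^sup>2 * M\<^sup>2)"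
  shows "volterra_solution \<tau> l z (\<lambda>j. suminf (\<lambda>m. l ^ m *\<^sub>R volterra_term \<tau> z j m))"
  unfolding volterra_solution_def
proof
  fix j
  let ?f = "\<lambda>j m. l ^ m *\<^sub>R volterra_term \<tau> z j m"
  have s: "summable (?f i)" for i
    by (rule summable_norm_cancel[OF volterra_term_summable[OF assms]])
  have bl: "bounded_linear (\<lambda>x. l *\<^sub>R (x \<otimes>\<^sub>1 tensorization \<tau> (z j)))"
    by (rule bounded_linear_compose[OF bounded_linear_scaleR_right bounded_linear_tensor_right])
  have "suminf (?f j) = suminf (\<lambda>m. ?f j (Suc m)) + to_completion (tensor [])"
    using suminf_split_head[OF s[of j]] by (simp add: volterra_term_0)
  also have "suminf (\<lambda>m. ?f j (Suc m)) = suminf (\<lambda>m. l *\<^sub>R (?f (Suc j) m \<otimes>\<^sub>1 tensorization \<tau> (z j)))"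
    by (simp add: volterra_term_Suc linear_cmul[OF linear_tensor_right])
  also have "\<dots> = l *\<^sub>R (suminf (?f (Suc j)) \<otimes>\<^sub>1 tensorization \<tau> (z j))"
    by (rule bounded_linear.suminf[OF bl s, symmetric])
  finally show "suminf (?f j) = l *\<^sub>R (suminf (?f (Suc j)) \<otimes>\<^sub>1 tensorization \<tau> (z j)) + to_completion (tensor [])" .
qed

lemma volterra_solution_ex1:
  fixes z :: "nat \<Rightarrow> real ^ 'n"
  assumes "z \<in> K_ball M" "\<tau>\<^sup>2 * M\<^sup>2 < 1" "0 < l" "l < sqrt (1 - \<tau>\<^sup>2 * M\<^sup>2)"
  shows "\<exists>!x. volterra_solution \<tau> l z x"
  using volterra_solution_series[OF assms] volterra_solution_unique by blast

lemma volterra_series: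
  fixes z :: "nat \<Rightarrow> real ^ 'n"
  assumes "z \<in> K_ball M" "\<tau>\<^sup>2 * M\<^sup>2 < 1" "0 < l" "l < sqrt (1 - \<tau>\<^sup>2 * M\<^sup>2)"
  shows "volterra \<tau> l z = to_completion (tensor []) +
    suminf (\<lambda>j. l ^ Suc j *\<^sub>R to_completion (tensor (map (\<lambda>i. tensorization \<tau> (z i)) (rev [0..<Suc j]))))"
proof -
  have "volterra \<tau> l z = suminf (\<lambda>m. l ^ m *\<^sub>R volterra_term \<tau> z 0 m)"
  proof -
    have "(THE x. volterra_solution \<tau> l z x) = (\<lambda>j. suminf (\<lambda>m. l ^ m *\<^sub>R volterra_term \<tau> z j m))"
      by (rule the1_equality) (rule volterra_solution_ex1[OF assms], rule volterra_solution_series[OF assms])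
    then show ?thesis by (simp add: volterra_def)
  qed
  also have "\<dots> = to_completion (tensor []) + suminf (\<lambda>m. l ^ Suc m *\<^sub>R volterra_term \<tau> z 0 (Suc m))"
    using suminf_split_head[OF summable_norm_cancel[OF volterra_term_summable[OF assms, of 0]]]
    by (simp add: volterra_term_0)
  finally show ?thesis by (simp add: volterra_term_def)
qed

section \<open>Kernel sections and continuous functions\<close>

definition kernel_combinations :: "'a set \<Rightarrow> ('a \<Rightarrow> 'a \<Rightarrow> real) \<Rightarrow> ('a \<Rightarrow> real) set" where
  "kernel_combinations S K = {\<lambda>x. \<Sum>i = 1..n. a i * K (z i) x | (n::nat) a z. \<forall>i\<in>{1..n}. z i \<in> S}"

text \<open>
  Functions on \<open>S\<close> are represented by extensional functions, which take a fixed value outside \<open>S\<close>.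
\<close>

definition kernel_sections :: "'a set \<Rightarrow> ('a \<Rightarrow> 'a \<Rightarrow> real) \<Rightarrow> ('a \<Rightarrow> real) set" where
  "kernel_sections S K = {f \<in> extensional S.
     \<exists>g. (\<forall>m::nat. g m \<in> kernel_combinations S K) \<and> uniform_limit S g f sequentially}"

definition continuous_functions :: "'a::topological_space set \<Rightarrow> ('a \<Rightarrow> real) set" where
  "continuous_functions S = {f \<in> extensional S. continuous_on S f}"

end

theory Submission
  imports Defs
begin

(* The functionals z \<mapsto> <a, H(z)> with a in the feature space contain every monomial in the entries of
  z, since a may be taken to be a tensor of tensors of vectors; Stone-Weierstrass applies to
  the algebra they generate. Conversely each such functional is a uniform limit of kernel
  combinations: projecting a (approximately) to the span of the range of H changes the functional
  uniformly little, because H is bounded. *)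

section \<open>Feature maps\<close>

text \<open>The witness is a near-minimiser of the distance from \<open>a\<close> to \<open>U\<close>.\<close>

lemma subspace_approx_orthogonal:
  fixes a :: "'a::real_inner"
  assumes U: "subspace U" and e: "0 < e"
  obtains y where "y \<in> U" "\<And>u. u \<in> U \<Longrightarrow> \<bar>inner (a - y) u\<bar> \<le> e * norm u"
proof -
  define D where "D = (INF y\<in>U. (norm (a - y))\<^sup>2)"
  have bdd: "bdd_below ((\<lambda>y. (norm (a - y))\<^sup>2) ` U)"
    by (rule bdd_belowI[of _ 0]) auto
  have "U \<noteq> {}" using subspace_0[OF U] by blast
  moreover have "D < D + e\<^sup>2" using e by simp
  ultimately obtain y where y: "y \<in> U" "(norm (a - y))\<^sup>2 < D + e\<^sup>2"
    unfolding D_def using bdd by (subst (asm) cINF_less_iff) auto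
  have "\<bar>inner (a - y) u\<bar> \<le> e * norm u" if u: "u \<in> U" for u
  proof (cases "u = 0")
    case False
    define p where "p = inner (a - y) u"
    \<comment> \<open>\<open>t *\<^sub>R u\<close> is the projection of \<open>a - y\<close> onto
      the line through \<open>u\<close>. Moving \<open>y\<close> by it lowers the squared distance
      by \<open>p\<^sup>2 / (norm u)\<^sup>2\<close>, yet \<open>y\<close> is already within
      \<open>e\<^sup>2\<close> of the infimum \<open>D\<close>.\<close>
    define t where "t = p / (norm u)\<^sup>2"
    have "y + t *\<^sub>R u \<in> U" by (intro subspace_add subspace_scale U y u)
    then have "D \<le> (norm (a - (y + t *\<^sub>R u)))\<^sup>2"
      unfolding D_def by (rule cINF_lower[OF bdd])
    also have "\<dots> = (norm (a - y))\<^sup>2 - 2 * t * p + t\<^sup>2 * (norm u)\<^sup>2"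
      unfolding p_def power2_norm_eq_inner
      by (simp add: inner_diff_left inner_diff_right inner_add_left inner_add_right
          inner_commute power2_eq_square algebra_simps)
    also have "\<dots> = (norm (a - y))\<^sup>2 - p\<^sup>2 / (norm u)\<^sup>2"
      using False by (simp add: t_def power2_eq_square field_simps)
    finally have "p\<^sup>2 / (norm u)\<^sup>2 \<le> e\<^sup>2" using y(2) by linarith
    then have "p\<^sup>2 \<le> (e * norm u)\<^sup>2"
      using False by (simp add: field_simps power_mult_distrib)
    then show ?thesis
      unfolding p_def using e by (simp add: abs_le_square_iff[symmetric] abs_mult)
  qed simp
  with y(1) show ?thesis by (rule that)
qed

lemma kernel_combination_of_span:
  fixes H :: "'a \<Rightarrow> 'b::real_inner"
  assumes "y \<in> span (H ` S)"
  shows "(\<lambda>x. inner y (H x)) \<in> kernel_combinations S (\<lambda>z x. inner (H z) (H x))"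
proof -
  obtain t r where t: "finite t" "t \<subseteq> H ` S" "y = (\<Sum>v\<in>t. r v *\<^sub>R v)"
    using assms unfolding span_explicit by blast
  \<comment> \<open>\<open>kernel_combinations\<close> sums over \<open>{1..n}\<close>, so the
    finite set \<open>t\<close> is enumerated from 1.\<close>
  obtain h where h: "bij_betw h {1..card t} t"
    using ex_bij_betw_nat_finite_1[OF t(1)] by blast
  have "\<exists>z. z \<in> S \<and> H z = h i" if "i \<in> {1..card t}" for i
    using bij_betwE[OF h] that t(2) by (metis image_iff subsetD)
  then obtain z where z: "\<And>i. i \<in> {1..card t} \<Longrightarrow> z i \<in> S \<and> H (z i) = h i"
    by metis
  have "y = (\<Sum>i=1..card t. r (h i) *\<^sub>R h i)"
    unfolding t(3) by (rule sum.reindex_bij_betw[OF h, symmetric])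
  also have "\<dots> = (\<Sum>i=1..card t. r (h i) *\<^sub>R H (z i))"
    by (rule sum.cong) (use z in auto)
  finally have "(\<lambda>x. inner y (H x)) =
      (\<lambda>x. \<Sum>i=1..card t. r (h i) * inner (H (z i)) (H x))"
    by (simp add: inner_sum_left)
  then show ?thesis
    unfolding kernel_combinations_def using z
    by (intro CollectI exI[of _ "card t"] exI[of _ "\<lambda>i. r (h i)"] exI[of _ z]) auto
qed

text \<open>Replace \<open>a\<close> by an element \<open>y\<close> of the span whose residual
  \<open>a - y\<close> is nearly orthogonal to that span. The error at \<open>x\<close> is then at
  most a small multiple of \<open>norm (H x)\<close>, hence uniformly small.\<close>

lemma feature_functional_approx:
  fixes H :: "'a \<Rightarrow> 'b::real_inner"
  assumes bound: "\<And>x. x \<in> S \<Longrightarrow> norm (H x) \<le> B" and e: "0 < e"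
  obtains g where "g \<in> kernel_combinations S (\<lambda>z x. inner (H z) (H x))"
    "\<And>x. x \<in> S \<Longrightarrow> \<bar>inner a (H x) - g x\<bar> < e"
proof -
  \<comment> \<open>Positive whatever the sign of \<open>B\<close>, and strictly above every
    \<open>norm (H x)\<close>, which makes the final inequality strict.\<close>
  define C where "C = \<bar>B\<bar> + 1"
  have C: "0 < C" by (simp add: C_def)
  have "0 < e / C" using e C by simp
  then obtain y where y: "y \<in> span (H ` S)"
      "\<And>u. u \<in> span (H ` S) \<Longrightarrow> \<bar>inner (a - y) u\<bar> \<le> e / C * norm u"
    using subspace_approx_orthogonal[OF subspace_span, of "e / C" "H ` S" a] by blast
  have "\<bar>inner a (H x) - inner y (H x)\<bar> < e" if x: "x \<in> S" for x
  proof -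
    have "\<bar>inner a (H x) - inner y (H x)\<bar> \<le> e / C * norm (H x)"
      using y(2)[of "H x"] x by (simp add: span_base inner_diff_left)
    also have "\<dots> < e / C * C"
      using bound[OF x] e C by (intro mult_strict_left_mono) (auto simp: C_def)
    finally show ?thesis using C by simp
  qed
  with kernel_combination_of_span[OF y(1)] show ?thesis by (rule that)
qed

section \<open>Uniform limits of kernel combinations\<close>

lemma kernel_sectionsI:
  assumes "f \<in> extensional S"
    and "\<And>e. 0 < e \<Longrightarrow> \<exists>g \<in> kernel_combinations S K. \<forall>x\<in>S. \<bar>f x - g x\<bar> < e"
  shows "f \<in> kernel_sections S K"
proof -
  \<comment> \<open>The tolerances 1/(n+1) turn approximation at each single accuracy into one
    uniformly convergent sequence.\<close>
  have "\<exists>g \<in> kernel_combinations S K. \<forall>x\<in>S. \<bar>f x - g x\<bar> < inverse (real (Suc n))" for n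
    by (rule assms(2)) simp
  then obtain g where g: "\<And>n. g n \<in> kernel_combinations S K"
      "\<And>n x. x \<in> S \<Longrightarrow> \<bar>f x - g n x\<bar> < inverse (real (Suc n))"
    by metis
  have "uniform_limit S g f sequentially"
  proof (rule uniform_limitI)
    fix e :: real assume "0 < e"
    then have "\<forall>\<^sub>F n in sequentially. inverse (real (Suc n)) < e"
      using LIMSEQ_inverse_real_of_nat by (rule order_tendstoD(2)[rotated])
    then show "\<forall>\<^sub>F n in sequentially. \<forall>x\<in>S. dist (g n x) (f x) < e"
    proof eventually_elim
      case (elim n)
      then show ?case using g(2)[of _ n] by (force simp: dist_real_def abs_minus_commute)
    qed
  qed
  with assms(1) g(1) show ?thesis by (auto simp: kernel_sections_def)
qed

lemma kernel_sections_continuous: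
  assumes "\<And>z. z \<in> S \<Longrightarrow> continuous_on S (K z)"
  shows "kernel_sections S K \<subseteq> continuous_functions S"
proof
  fix f assume "f \<in> kernel_sections S K"
  then obtain g where f: "f \<in> extensional S" "uniform_limit S g f sequentially"
    and g: "\<And>m::nat. g m \<in> kernel_combinations S K"
    by (auto simp: kernel_sections_def)
  have "continuous_on S (g m)" for m
    using g[of m] assms unfolding kernel_combinations_def by (auto intro!: continuous_intros)
  with f show "f \<in> continuous_functions S"
    unfolding continuous_functions_def
    by (auto intro!: uniform_limit_theorem[OF _ f(2)])
qed

section \<open>Polynomials in the entries of a sequence\<close>

text \<open>These are the functions obtained by pairing the feature map with a tensor of tensors:
  \<open>m\<close> is the outer degree and \<open>length (W i)\<close> the inner degree at time -i.
  An empty list contributes the factor 1.\<close>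

definition sequence_monomial :: "nat \<Rightarrow> (nat \<Rightarrow> 'a list) \<Rightarrow> (nat \<Rightarrow> 'a::real_inner) \<Rightarrow> real" where
  "sequence_monomial m W z = (\<Prod>i<m. prod_list (map (inner (z i)) (W i)))"

text \<open>Only linear operations are constructors, because only these carry over to functionals
  \<open>inner a (H z)\<close> in \<open>sequence_polynomial_feature\<close>. Closure under products
  is proved separately for Stone-Weierstrass.\<close>

inductive sequence_polynomial :: "((nat \<Rightarrow> 'a::real_inner) \<Rightarrow> real) \<Rightarrow> bool" where
  monomial: "sequence_polynomial (sequence_monomial m W)"
| add: "sequence_polynomial f \<Longrightarrow> sequence_polynomial g \<Longrightarrow> sequence_polynomial (\<lambda>z. f z + g z)"
| scale: "sequence_polynomial f \<Longrightarrow> sequence_polynomial (\<lambda>z. c * f z)"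

lemma sequence_monomial_pad:
  assumes "m \<le> n"
  shows "sequence_monomial m W z = sequence_monomial n (\<lambda>i. if i < m then W i else []) z"
  unfolding sequence_monomial_def
  by (rule prod.mono_neutral_cong_left) (use assms in auto)

text \<open>Once both monomials are padded with empty lists to a common length, multiplying them
  amounts to appending their lists entry by entry.\<close>

lemma sequence_monomial_mult:
  "sequence_polynomial (\<lambda>z. sequence_monomial m W z * sequence_monomial n V z)"
proof -
  let ?W = "\<lambda>i. if i < m then W i else []" and ?V = "\<lambda>i. if i < n then V i else []"
  have "(\<lambda>z. sequence_monomial m W z * sequence_monomial n V z) =
      sequence_monomial (max m n) (\<lambda>i. ?W i @ ?V i)"
    by (rule ext, subst sequence_monomial_pad[of m "max m n"], simp,
        subst sequence_monomial_pad[of n "max m n"], simp)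
       (simp only: sequence_monomial_def prod.distrib[symmetric] map_append prod_list.append)
  then show ?thesis by (simp add: sequence_polynomial.monomial)
qed

lemma sequence_polynomial_mult:
  assumes "sequence_polynomial f" "sequence_polynomial g"
  shows "sequence_polynomial (\<lambda>z. f z * g z)"
  using assms(1)
proof induction
  case (monomial m W)
  show ?case
    using assms(2)
  proof induction
    case (monomial n V)
    show ?case by (rule sequence_monomial_mult)
  next
    case (add f g)
    then show ?case using sequence_polynomial.add by (fastforce simp: distrib_left)
  next
    case (scale f c)
    then show ?case using sequence_polynomial.scale[of _ c] by (fastforce simp: mult.left_commute)
  qed
next
  case (add f1 f2)
  then show ?case using sequence_polynomial.add by (fastforce simp: distrib_right)
next
  case (scale f c)
  then show ?case using sequence_polynomial.scale[of _ c] by (fastforce simp: mult.assoc)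
qed

lemma sequence_polynomial_const: "sequence_polynomial (\<lambda>_. c)"
  using scale[OF monomial[of 0], of c] by (simp add: sequence_monomial_def)

lemma sequence_polynomial_separates:
  assumes "z \<noteq> w"
  obtains f where "sequence_polynomial f" "f z \<noteq> f w"
proof -
  obtain k where k: "z k \<noteq> w k" using assms by blast
  \<comment> \<open>The linear functional \<open>inner (y k) (z k - w k)\<close> written as a
    monomial. Its values at \<open>z\<close> and \<open>w\<close> differ by the squared norm of
    \<open>z k - w k\<close>.\<close>
  define f where "f = sequence_monomial (Suc k) (\<lambda>i. if i = k then [z k - w k] else [])"
  have f: "f y = inner (y k) (z k - w k)" for y
    by (simp add: f_def sequence_monomial_def if_distrib prod.delta)
  have "f z - f w = inner (z k - w k) (z k - w k)"
    by (simp only: f inner_diff_left)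
  then have "f z \<noteq> f w" using k by auto
  moreover have "sequence_polynomial f" unfolding f_def by (rule monomial)
  ultimately show ?thesis by (rule that[rotated])
qed

section \<open>Stone-Weierstrass on the compact set of bounded sequences\<close>

lemma continuous_on_prod_list [continuous_intros]:
  fixes f :: "'b \<Rightarrow> 'a::topological_space \<Rightarrow> real"
  assumes "\<And>v. v \<in> set vs \<Longrightarrow> continuous_on S (f v)"
  shows "continuous_on S (\<lambda>x. prod_list (map (\<lambda>v. f v x) vs))"
  using assms by (induction vs) (auto intro!: continuous_intros)

lemma continuous_on_sequence_polynomial:
  "sequence_polynomial f \<Longrightarrow> continuous_on S f"
proof (induction rule: sequence_polynomial.induct)
  case (monomial m W)
  then show ?case
    unfolding sequence_monomial_def
    by (intro continuous_intros continuous_on_product_then_coordinatewise[OF continuous_on_id])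
qed (auto intro: continuous_intros)

text \<open>A product of closed balls, so Tychonoff's theorem applies.\<close>

lemma compact_K_ball: "compact (K_ball M :: (nat \<Rightarrow> real ^ 'n) set)"
proof -
  have "K_ball M = PiE UNIV (\<lambda>_. cball (0 :: real ^ 'n) M)"
    by (auto simp: K_ball_def PiE_def Pi_def)
  moreover have "compactin (product_topology (\<lambda>_. euclidean) UNIV) (PiE (UNIV :: nat set) (\<lambda>_. cball (0 :: real ^ 'n) M))"
    unfolding compactin_PiE compactin_euclidean_iff by simp
  ultimately show ?thesis
    by (simp add: euclidean_product_topology)
qed

lemma sequence_polynomial_dense:
  fixes f :: "(nat \<Rightarrow> real ^ 'n) \<Rightarrow> real"
  assumes "continuous_on (K_ball M) f" "0 < e"
  obtains g where "sequence_polynomial g" "\<And>z. z \<in> K_ball M \<Longrightarrow> \<bar>f z - g z\<bar> < e"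
proof -
  have "\<exists>g. sequence_polynomial g \<and> (\<forall>z\<in>K_ball M. \<bar>f z - g z\<bar> < e)"
    by (rule Stone_Weierstrass_HOL[OF compact_K_ball])
       (use assms in \<open>auto intro: sequence_polynomial_const continuous_on_sequence_polynomial
          sequence_polynomial.add sequence_polynomial_mult elim: sequence_polynomial_separates\<close>)
  then show ?thesis using that by blast
qed

section \<open>The Volterra feature map\<close>

text \<open>The words are reversed to match \<open>volterra_term\<close>, where the most recent
  entry, index 0, is the rightmost factor. Different degrees are orthogonal.\<close>

lemma inner_tensor_rev_upt:
  "inner (tensor (map f (rev [0..<m]))) (tensor (map g (rev [0..<n]))) =
     (if m = n then \<Prod>i<m. inner (f i) (g i) else 0)"
proof -
  have "word_inner (map f (rev [0..<m])) (map g (rev [0..<m])) = (\<Prod>i<m. inner (f i) (g i))"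
    by (induction m) simp_all
  then show ?thesis
    by (auto simp: inner_tensor_algebra_def tensor_inner_tensor) (simp add: word_inner_def)
qed

text \<open>Only the component of degree \<open>length vs\<close> survives the pairing, by
  orthogonality of the degrees.\<close>

lemma inner_tensorization_word:
  fixes z :: "'a::real_inner"
  assumes "\<tau>\<^sup>2 * (norm z)\<^sup>2 < 1"
  shows "inner (tensorization \<tau> z) (to_completion (tensor vs)) =
    \<tau> ^ length vs * prod_list (map (inner z) vs)"
proof -
  have word: "word_inner (replicate (length vs) z) vs = prod_list (map (inner z) vs)"
    by (induction vs) auto
  have "inner (\<tau> ^ i *\<^sub>R to_completion (tensor (replicate i z))) (to_completion (tensor vs)) =
      (if i = length vs then \<tau> ^ i * prod_list (map (inner z) vs) else 0)" for i
  proof (cases "i = length vs")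
    case True
    then show ?thesis using word by (simp add: inner_tensor_algebra_def tensor_inner_tensor)
  next
    case False
    then show ?thesis by (simp add: inner_tensor)
  qed
  moreover have "(\<lambda>i. inner (\<tau> ^ i *\<^sub>R to_completion (tensor (replicate i z)))
      (to_completion (tensor vs))) sums inner (tensorization \<tau> z) (to_completion (tensor vs))"
    by (rule bounded_linear.sums[OF bounded_linear_inner_left tensorization_sums[OF assms]])
  ultimately show ?thesis
    using sums_single[of "length vs" "\<lambda>i. \<tau> ^ i * prod_list (map (inner z) vs)"]
    by (simp add: sums_unique2)
qed

context
  fixes M \<tau> l :: real
  assumes M: "\<tau>\<^sup>2 * M\<^sup>2 < 1" and l: "0 < l" "l < sqrt (1 - \<tau>\<^sup>2 * M\<^sup>2)"
begin

lemma volterra_sums: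
  fixes z :: "nat \<Rightarrow> real ^ 'n"
  assumes z: "z \<in> K_ball M"
  shows "(\<lambda>m. l ^ m *\<^sub>R volterra_term \<tau> z 0 m) sums volterra \<tau> l z"
proof -
  have s: "summable (\<lambda>m. l ^ m *\<^sub>R volterra_term \<tau> z 0 m)"
    by (rule summable_norm_cancel[OF volterra_term_summable[OF z M l]])
  have "volterra \<tau> l z = suminf (\<lambda>m. l ^ m *\<^sub>R volterra_term \<tau> z 0 m)"
    using suminf_split_head[OF s] volterra_series[OF z M l]
    by (simp add: volterra_term_def)
  with s show ?thesis by (simp add: summable_sums)
qed

text \<open>Only the term of outer degree \<open>m\<close> in the Volterra series survives. With
  tensorizations as \<open>f i\<close> this computes the kernel term by term; with tensors of words
  it yields monomials.\<close>

lemma inner_volterra_word: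
  fixes z :: "nat \<Rightarrow> real ^ 'n"
  assumes z: "z \<in> K_ball M"
  shows "inner (volterra \<tau> l z) (to_completion (tensor (map f (rev [0..<m])))) =
    l ^ m * (\<Prod>i<m. inner (tensorization \<tau> (z i)) (f i))"
proof -
  let ?w = "to_completion (tensor (map f (rev [0..<m])))"
  have "inner (l ^ k *\<^sub>R volterra_term \<tau> z 0 k) ?w =
      (if k = m then l ^ k * (\<Prod>i<k. inner (tensorization \<tau> (z i)) (f i)) else 0)" for k
    by (simp add: volterra_term_def inner_tensor_rev_upt)
  moreover have "(\<lambda>k. inner (l ^ k *\<^sub>R volterra_term \<tau> z 0 k) ?w) sums inner (volterra \<tau> l z) ?w"
    by (rule bounded_linear.sums[OF bounded_linear_inner_left volterra_sums[OF z]])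
  ultimately show ?thesis
    using sums_single[of m "\<lambda>k. l ^ k * (\<Prod>i<k. inner (tensorization \<tau> (z i)) (f i))"]
    by (simp add: sums_unique2)
qed

lemma K_ball_entry_bound:
  assumes "z \<in> K_ball M"
  shows "\<tau>\<^sup>2 * (norm (z i))\<^sup>2 \<le> \<tau>\<^sup>2 * M\<^sup>2" "\<tau>\<^sup>2 * (norm (z i))\<^sup>2 < 1"
proof -
  have "(norm (z i))\<^sup>2 \<le> M\<^sup>2"
    using assms by (auto simp: K_ball_def intro: power_mono)
  then show "\<tau>\<^sup>2 * (norm (z i))\<^sup>2 \<le> \<tau>\<^sup>2 * M\<^sup>2" by (intro mult_left_mono) auto
  with M show "\<tau>\<^sup>2 * (norm (z i))\<^sup>2 < 1" by simp
qed

section \<open>Norm bounds and continuity of the kernel\<close>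

text \<open>Ratio of the geometric series dominating the Volterra series: each further factor brings
  \<open>l\<close> and a tensorization of norm at most
  \<open>1 / sqrt (1 - \<tau>\<^sup>2 * M\<^sup>2)\<close>.\<close>

definition volterra_ratio :: real where
  "volterra_ratio = l / sqrt (1 - \<tau>\<^sup>2 * M\<^sup>2)"

lemma volterra_ratio: "0 \<le> volterra_ratio" "volterra_ratio < 1"
  using M l by (auto simp: volterra_ratio_def)

lemma norm_volterra_term_le:
  fixes z :: "nat \<Rightarrow> real ^ 'n"
  assumes z: "z \<in> K_ball M"
  shows "norm (l ^ m *\<^sub>R volterra_term \<tau> z 0 m) \<le> volterra_ratio ^ m"
proof (rule power2_le_imp_le)
  have "(norm (l ^ m *\<^sub>R volterra_term \<tau> z 0 m))\<^sup>2 =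
      (l\<^sup>2) ^ m * (\<Prod>i<m. 1 / (1 - \<tau>\<^sup>2 * (norm (z i))\<^sup>2))"
    using K_ball_entry_bound(2)[OF z] l
    by (simp add: power2_norm_eq_inner volterra_term_def inner_tensor_rev_upt inner_tensorization
        power_mult_distrib flip: power2_eq_square power_mult)
       (simp add: mult.commute flip: power_mult)
  also have "\<dots> \<le> (l\<^sup>2) ^ m * (\<Prod>i<m. 1 / (1 - \<tau>\<^sup>2 * M\<^sup>2))"
    using K_ball_entry_bound[OF z] M
    by (intro mult_left_mono prod_mono conjI divide_left_mono) (auto simp: less_imp_le)
  also have "\<dots> = (volterra_ratio ^ m)\<^sup>2"
    using M by (simp add: volterra_ratio_def power_divide power_one_over flip: power_mult)
       (simp add: power_mult mult.commute[of m])
  finally show "(norm (l ^ m *\<^sub>R volterra_term \<tau> z 0 m))\<^sup>2 \<le> (volterra_ratio ^ m)\<^sup>2" .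
  show "0 \<le> volterra_ratio ^ m" using volterra_ratio by simp
qed

text \<open>Compare with the geometric series. The bound is independent of \<open>z\<close>, as
  \<open>feature_functional_approx\<close> demands.\<close>

lemma norm_volterra_le:
  fixes z :: "nat \<Rightarrow> real ^ 'n"
  assumes z: "z \<in> K_ball M"
  shows "norm (volterra \<tau> l z) \<le> 1 / (1 - volterra_ratio)"
proof -
  have s: "(\<lambda>m. volterra_ratio ^ m) sums (1 / (1 - volterra_ratio))"
    using volterra_ratio by (intro geometric_sums) simp
  have "norm (suminf (\<lambda>m. l ^ m *\<^sub>R volterra_term \<tau> z 0 m)) \<le> suminf (\<lambda>m. volterra_ratio ^ m)"
    by (rule norm_suminf_le) (use norm_volterra_term_le[OF z] sums_summable[OF s] in auto)
  then show ?thesis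
    using sums_unique[OF s] sums_unique[OF volterra_sums[OF z]] by simp
qed

text \<open>The kernel is a series of explicit rational functions of finitely many entries of
  \<open>w\<close>, and the geometric majorant makes it converge uniformly.\<close>

lemma continuous_on_volterra_kernel:
  fixes z :: "nat \<Rightarrow> real ^ 'n"
  assumes z: "z \<in> K_ball M"
  shows "continuous_on (K_ball M) (volterra_kernel \<tau> l z)"
proof -
  let ?H = "volterra \<tau> l z"
  let ?f = "\<lambda>m w. inner ?H (l ^ m *\<^sub>R volterra_term \<tau> w 0 m)"
  have "uniform_limit (K_ball M) (\<lambda>n w. \<Sum>m<n. ?f m w) (\<lambda>w. suminf (\<lambda>m. ?f m w)) sequentially"
  proof (rule Weierstrass_m_test)
    show "norm (?f m w) \<le> norm ?H * volterra_ratio ^ m" if "w \<in> K_ball M" for m w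
      using Cauchy_Schwarz_ineq2[of ?H "l ^ m *\<^sub>R volterra_term \<tau> w 0 m"]
        mult_left_mono[OF norm_volterra_term_le[OF that, of m] norm_ge_zero[of ?H]]
      by simp
    show "summable (\<lambda>m. norm ?H * volterra_ratio ^ m)"
      using volterra_ratio by (intro summable_mult summable_geometric) simp
  qed
  moreover have "continuous_on (K_ball M) (?f m)" for m
  proof -
    \<comment> \<open>One \<open>l ^ m\<close> comes from the series of \<open>w\<close>, the other
      from that of \<open>z\<close> through \<open>inner_volterra_word\<close>.\<close>
    have "continuous_on (K_ball M)
        (\<lambda>w. l ^ m * (l ^ m * (\<Prod>i<m. 1 / (1 - \<tau>\<^sup>2 * inner (z i) (w i)))))"
    proof (intro continuous_intros ballI
        continuous_on_product_then_coordinatewise[OF continuous_on_id])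
      fix i and w :: "nat \<Rightarrow> real ^ 'n" assume w: "w \<in> K_ball M"
      \<comment> \<open>Keeps the denominator at least
        \<open>1 - \<tau>\<^sup>2 * M\<^sup>2\<close>, hence positive.\<close>
      have "\<tau>\<^sup>2 * inner (z i) (w i) \<le> \<tau>\<^sup>2 * (M * M)"
      proof (intro mult_left_mono)
        have "inner (z i) (w i) \<le> norm (z i) * norm (w i)" by (rule norm_cauchy_schwarz)
        also have "\<dots> \<le> M * M"
          using z w by (intro mult_mono) (auto simp: K_ball_def intro: order_trans[OF norm_ge_zero])
        finally show "inner (z i) (w i) \<le> M * M" .
      qed simp
      with M show "1 - \<tau>\<^sup>2 * inner (z i) (w i) \<noteq> 0" by (simp add: power2_eq_square)
    qed
    moreover have "?f m w = l ^ m * (l ^ m * (\<Prod>i<m. 1 / (1 - \<tau>\<^sup>2 * inner (z i) (w i))))"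
      if w: "w \<in> K_ball M" for w :: "nat \<Rightarrow> real ^ 'n"
      using inner_volterra_word[OF z, of "\<lambda>i. tensorization \<tau> (w i)" m]
      by (simp add: volterra_term_def
          inner_tensorization[OF K_ball_entry_bound(2)[OF z] K_ball_entry_bound(2)[OF w]])
    ultimately show ?thesis by (simp only: cong: continuous_on_cong)
  qed
  ultimately have "continuous_on (K_ball M) (\<lambda>w. suminf (\<lambda>m. ?f m w))"
    by (intro uniform_limit_theorem[where F = sequentially and f = "\<lambda>n w. \<Sum>m<n. ?f m w"])
       (auto intro!: always_eventually continuous_on_sum)
  moreover have "volterra_kernel \<tau> l z w = suminf (\<lambda>m. ?f m w)" if w: "w \<in> K_ball M" for w
    unfolding volterra_kernel_def
    by (rule sums_unique, rule bounded_linear.sums[OF bounded_linear_inner_right volterra_sums[OF w]])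
  ultimately show ?thesis by (simp cong: continuous_on_cong)
qed

text \<open>Pairing with a tensor of tensors of words gives a monomial up to a nonzero constant;
  sums and multiples follow by linearity in \<open>a\<close>.\<close>

lemma sequence_polynomial_feature:
  assumes "\<tau> > 0" "sequence_polynomial f"
  shows "\<exists>a. \<forall>z \<in> K_ball M. f z = inner a (volterra \<tau> l z :: 'n::finite double_tensor_algebra)"
  using assms(2)
proof induction
  case (monomial m W)
  let ?w = "to_completion (tensor (map (\<lambda>i. to_completion (tensor (W i))) (rev [0..<m])))
    :: 'n double_tensor_algebra"
  \<comment> \<open>The powers of \<open>l\<close> and \<open>\<tau>\<close> picked up in the outer
    and inner degrees; they are positive, so \<open>?w\<close> can be rescaled by
    \<open>inverse c\<close>.\<close>
  define c where "c = l ^ m * (\<Prod>i<m. \<tau> ^ length (W i))"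
  have c: "c \<noteq> 0" using assms(1) l by (simp add: c_def)
  have "inner (volterra \<tau> l z) ?w = c * sequence_monomial m W z" if z: "z \<in> K_ball M" for z
    by (simp add: inner_volterra_word[OF z] inner_tensorization_word[OF K_ball_entry_bound(2)[OF z]]
        sequence_monomial_def c_def prod.distrib)
  with c have "\<forall>z\<in>K_ball M. sequence_monomial m W z = inner (inverse c *\<^sub>R ?w) (volterra \<tau> l z)"
    by (simp add: inner_commute[of ?w])
  then show ?case by blast
next
  case (add f g)
  then obtain a b where "\<forall>z\<in>K_ball M. f z = inner a (volterra \<tau> l z)"
      "\<forall>z\<in>K_ball M. g z = inner b (volterra \<tau> l z)" by blast
  then have "\<forall>z\<in>K_ball M. f z + g z = inner (a + b) (volterra \<tau> l z)"
    by (simp add: inner_add_left)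
  then show ?case by blast
next
  case (scale f c)
  then obtain a where "\<forall>z\<in>K_ball M. f z = inner a (volterra \<tau> l z)" by blast
  then have "\<forall>z\<in>K_ball M. c * f z = inner (c *\<^sub>R a) (volterra \<tau> l z)" by simp
  then show ?case by blast
qed

end

section \<open>Universality from the two inclusions\<close>

theorem mainTheorem3:
  fixes M \<tau> l :: real
  assumes "M > 0" "\<tau> > 0" "\<tau>\<^sup>2 * M\<^sup>2 < 1"
    and "0 < l" "l < sqrt (1 - \<tau>\<^sup>2 * M\<^sup>2)"
  shows "kernel_sections (K_ball M :: (nat \<Rightarrow> real ^ 'n) set) (volterra_kernel \<tau> l) =
    continuous_functions (K_ball M)"
proof
  note params = assms(3-5)
  let ?S = "K_ball M :: (nat \<Rightarrow> real ^ 'n) set"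
  show "kernel_sections ?S (volterra_kernel \<tau> l) \<subseteq> continuous_functions ?S"
    by (rule kernel_sections_continuous) (rule continuous_on_volterra_kernel[OF params])
  show "continuous_functions ?S \<subseteq> kernel_sections ?S (volterra_kernel \<tau> l)"
  proof
    fix f assume "f \<in> continuous_functions ?S"
    then have f: "f \<in> extensional ?S" "continuous_on ?S f"
      by (auto simp: continuous_functions_def)
    show "f \<in> kernel_sections ?S (volterra_kernel \<tau> l)"
    proof (rule kernel_sectionsI[OF f(1)])
      fix e :: real assume "0 < e"
      \<comment> \<open>Half of the error goes to the polynomial, half to replacing its functional
        by a kernel combination.\<close>
      then have e: "0 < e / 2" by simp
      obtain p where p: "sequence_polynomial p" "\<And>z. z \<in> ?S \<Longrightarrow> \<bar>f z - p z\<bar> < e / 2"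
        using sequence_polynomial_dense[OF f(2) e] by blast
      obtain a where a: "\<And>z. z \<in> ?S \<Longrightarrow> p z = inner a (volterra \<tau> l z)"
        using sequence_polynomial_feature[OF params assms(2) p(1)] by blast
      obtain g where g: "g \<in> kernel_combinations ?S (volterra_kernel \<tau> l)"
          "\<And>z. z \<in> ?S \<Longrightarrow> \<bar>inner a (volterra \<tau> l z) - g z\<bar> < e / 2"
        using feature_functional_approx[where S = ?S and H = "volterra \<tau> l",
            OF norm_volterra_le[OF params] e]
        \<comment> \<open>Unfolding exposes the kernel as the inner product of features that
          \<open>feature_functional_approx\<close> is stated for.\<close>
        unfolding volterra_kernel_def[abs_def] by blast
      have "\<bar>f z - g z\<bar> < e" if "z \<in> ?S" for z
        using p(2)[OF that] g(2)[OF that] a[OF that] by linarith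
      with g(1) show "\<exists>g\<in>kernel_combinations ?S (volterra_kernel \<tau> l). \<forall>z\<in>?S. \<bar>f z - g z\<bar> < e"
        by blast
    qed
  qed
qed

end
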